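(* Let $b:(0,\infty)\to\mathbb{R}$ be a regular boundary such that for each $T>0$, $b$ is continuously differentiable on $(0,T]$, and such that $|b'(t)|=O(t^{-\epsilon})$ as $t\downarrow 0$ for some $0<\epsilon<1/2$. Let $f$ be the continuous density function of the first-passage time $\inf\{t>0:\ W_t\le b(t)\}$ of a standard Brownian motion $W$ (started at $0$) to $b$. Let $\alpha\in\mathbb{R}$, $\beta\ge 0$, $\gamma>0$ and define $$\tilde b(t)=\frac{1+\beta\gamma t}{\sqrt{\gamma}}\,b\!\left(\frac{\gamma t}{1+\beta\gamma t}\right)+\alpha t,\qquad t>0.$$ Then the first-passage time $\inf\{t>0:\ W_t\le \tilde b(t)\}$ has a continuous density $\tilde f$ given by $$\tilde f(t)=\frac{\gamma\, f\!\left(\frac{\gamma t}{1+\beta\gamma t}\right)}{(1+\beta\gamma t)^{3/2}}\exp\!\left(-(1+\beta\gamma t)\,b\!\left(\tfrac{\gamma t}{1+\beta\gamma t}\right)\left[\tfrac{\beta}{2}\,b\!\left(\tfrac{\gamma t}{1+\beta\gamma t}\right)+\tfrac{\alpha}{\sqrt{\gamma}}\right]-\tfrac{\alpha^2 t}{2}\right).$$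
   Context: A boundary is a continuous function $b:(0,\infty)\to\mathbb{R}$ with $b(0):=\lim_{t\downarrow0}b(t)\le 0$; it is called regular if $P(\tau=0)=0$ for $\tau=\inf\{t>0: W_t\le b(t)\}$. Under the stated hypotheses on $b$ the first-passage time has a (possibly defective) continuous density. *)

theory Defs
  imports "HOL-Probability.Probability" "HOL-Library.Landau_Symbols"
begin

text \<open>
  Every path is required to be continuous, so that first-passage times are measurable although
  the probability space need not be complete.
\<close>

locale standard_brownian_motion = prob_space M for M :: "'a measure" +
  fixes W :: "real \<Rightarrow> 'a \<Rightarrow> real"
  assumes random_variable: "\<And>t. t \<ge> 0 \<Longrightarrow> W t \<in> borel_measurable M"
    and start_0: "AE \<omega> in M. W 0 \<omega> = 0"
    and continuous_paths: "\<And>\<omega>. \<omega> \<in> space M \<Longrightarrow> continuous_on {0..} (\<lambda>t. W t \<omega>)"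
    and normal_increments: "\<And>s t. 0 \<le> s \<Longrightarrow> s < t \<Longrightarrow>
      distributed M lborel (\<lambda>\<omega>. W t \<omega> - W s \<omega>) (normal_density 0 (sqrt (t - s)))"
    and indep_increments: "\<And>(n :: nat) (t :: nat \<Rightarrow> real). 0 \<le> t 0 \<Longrightarrow> mono_on {..n} t \<Longrightarrow>
      indep_vars (\<lambda>_. borel) (\<lambda>i \<omega>. W (t (Suc i)) \<omega> - W (t i) \<omega>) {..<n}"

text \<open>The value is \<^term>\<open>\<infinity> :: ereal\<close> on paths that never reach the boundary.\<close>

definition first_passage_time :: "(real \<Rightarrow> 'a \<Rightarrow> real) \<Rightarrow> (real \<Rightarrow> real) \<Rightarrow> 'a \<Rightarrow> ereal" where
  "first_passage_time W b \<omega> = Inf (ereal ` {t. t > 0 \<and> W t \<omega> \<le> b t})"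

text \<open>Boundaries live on \<open>(0,\<infinity>)\<close>; the values of \<open>b\<close> at \<open>t \<le> 0\<close> are junk and never used.\<close>

definition boundary :: "(real \<Rightarrow> real) \<Rightarrow> bool" where
  "boundary b \<longleftrightarrow> continuous_on {0<..} b \<and> (\<exists>l\<le>0. (b \<longlongrightarrow> l) (at_right 0))"

definition regular_boundary ::
    "'a measure \<Rightarrow> (real \<Rightarrow> 'a \<Rightarrow> real) \<Rightarrow> (real \<Rightarrow> real) \<Rightarrow> bool" where
  "regular_boundary M W b \<longleftrightarrow>
     boundary b \<and> measure M {\<omega> \<in> space M. first_passage_time W b \<omega> = 0} = 0"

text \<open>
  A possibly defective density on \<open>(0,\<infinity>)\<close>: no condition is put on the mass at infinity,
  while the set \<open>A = {0}\<close> excludes an atom at the origin.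
\<close>

definition has_continuous_density ::
    "'a measure \<Rightarrow> ('a \<Rightarrow> ereal) \<Rightarrow> (real \<Rightarrow> real) \<Rightarrow> bool" where
  "has_continuous_density M \<tau> f \<longleftrightarrow>
     \<tau> \<in> borel_measurable M \<and>
     continuous_on {0<..} f \<and> (\<forall>t>0. f t \<ge> 0) \<and>
     (\<forall>A \<in> sets borel. emeasure M {\<omega> \<in> space M. \<tau> \<omega> \<in> ereal ` A} =
        (\<integral>\<^sup>+ t \<in> A \<inter> {0<..}. ennreal (f t) \<partial>lborel))"

end

theory Submission
  imports Defs
begin

text \<open>
  Put \<open>c s = 1 - \<beta> s\<close>, \<open>t s = s / (\<gamma> c s)\<close> and \<open>X s = sqrt \<gamma> * c s * (W (t s) - \<alpha> t s)\<close>. Then \<open>W\<close> meets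
  the transformed boundary at time \<open>t s\<close> iff \<open>X\<close> meets \<open>b\<close> at time \<open>s\<close>. The Gaussian transition kernel of \<open>X\<close>
  is an \<open>h\<close>-transform of the heat kernel, so on \<open>[0,u]\<close> the law of \<open>X\<close> has density \<open>h (u, W u)\<close> with respect
  to that of \<open>W\<close>. Optional stopping of the martingale \<open>h (s, W s)\<close> at the first-passage time \<open>\<tau>\<close> of \<open>W\<close> to \<open>b\<close>,
  where \<open>W \<tau> = b \<tau>\<close>, gives \<open>P (X meets b before u) = E [h (\<tau>, b \<tau>); \<tau> \<le> u]\<close>, and a change of variables
  turns this into the stated density.
\<close>

section \<open>Gaussian averages and the Markov property\<close>

text \<open>For \<beta> > 0 the process X is a Brownian bridge of length 1/\<beta> with a prescribed
  end point, so its law is singular to that of W on the whole interval. Laws are therefore compared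
  only on [0,u] with \<beta> u < 1, which suffices because \<gamma> t / (1 + \<beta> \<gamma> t)
  stays below 1/\<beta>. The comparison produces the weight h at the terminal point (u, W u),
  although the event is already decided at \<tau>. Optional stopping moves the weight back to
  \<tau>, where the position b \<tau> is a function of \<tau> alone; hence the new density is the
  old one times an explicit function of time. Two limit passages carry this out. Events in
  continuous time are reduced to rational times, so that finite-dimensional laws determine their
  probabilities. The stopping time is approximated from the right by grid points, so that only the
  Markov property at fixed times is used. The power 3/2 combines two sources: 1 / sqrt (1 - \<beta>
  s) = sqrt (1 + \<beta> \<gamma> t) from h, and the Jacobian \<gamma> / (1 + \<beta> \<gamma> t)^2
  of the time change.\<close>

definition std_gauss :: "real measure" where
  "std_gauss = density lborel (\<lambda>x. ennreal (std_normal_density x))"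

lemma prob_space_std_gauss: "prob_space std_gauss"
  unfolding std_gauss_def using prob_space_normal_density[of 1 0] by simp

lemma sets_std_gauss [measurable_cong, simp]: "sets std_gauss = sets borel"
  by (simp add: std_gauss_def)

lemma space_std_gauss [simp]: "space std_gauss = UNIV"
  by (simp add: std_gauss_def)

lemma emeasure_std_gauss_UNIV [simp]: "emeasure std_gauss UNIV = 1"
  using prob_space.emeasure_space_1[OF prob_space_std_gauss] by simp

text \<open>The heat semigroup at time \<sigma>^2. Averaging over one fixed standard normal
  variable, instead of against a kernel depending on \<sigma>, includes \<sigma> = 0 as the identity
  and makes measurability and continuity in \<sigma> and \<open>x\<close> jointly
  accessible.\<close>

definition gauss_avg :: "real \<Rightarrow> (real \<Rightarrow> ennreal) \<Rightarrow> real \<Rightarrow> ennreal" where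
  "gauss_avg \<sigma> F x = (\<integral>\<^sup>+ z. F (x + \<sigma> * z) \<partial>std_gauss)"

lemma measurable_gauss_avg [measurable (raw)]:
  assumes [measurable]: "F \<in> borel_measurable borel" "\<sigma> \<in> borel_measurable N" "x \<in> borel_measurable N"
  shows "(\<lambda>\<omega>. gauss_avg (\<sigma> \<omega>) F (x \<omega>)) \<in> borel_measurable N"
proof -
  interpret prob_space std_gauss by (rule prob_space_std_gauss)
  show ?thesis unfolding gauss_avg_def by measurable
qed

lemma gauss_avg_0 [simp]: "gauss_avg 0 F x = F x"
  by (simp add: gauss_avg_def)

lemma gauss_avg_const [simp]: "gauss_avg \<sigma> (\<lambda>_. k) x = k"
  by (simp add: gauss_avg_def)

lemma gauss_avg_affine:
  "gauss_avg \<sigma> (\<lambda>y. F (a * y + m)) x = gauss_avg (a * \<sigma>) F (a * x + m)"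
  by (simp add: gauss_avg_def algebra_simps)

lemma gauss_avg_eq_normal_density:
  assumes [measurable]: "F \<in> borel_measurable borel" and "\<sigma> > 0"
  shows "gauss_avg \<sigma> F x = (\<integral>\<^sup>+ y. F y * ennreal (normal_density x \<sigma> y) \<partial>lborel)"
proof -
  have nd: "\<sigma> * normal_density x \<sigma> (x + \<sigma> * z) = std_normal_density z" for z
    using \<open>\<sigma> > 0\<close> by (simp add: normal_density_def real_sqrt_mult field_simps power2_eq_square)
  have "(\<integral>\<^sup>+ y. F y * ennreal (normal_density x \<sigma> y) \<partial>lborel)
      = ennreal \<sigma> * (\<integral>\<^sup>+ z. F (x + \<sigma> * z) * ennreal (normal_density x \<sigma> (x + \<sigma> * z)) \<partial>lborel)"
    using \<open>\<sigma> > 0\<close> by (subst nn_integral_real_affine[where c = \<sigma> and t = x]) auto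
  also have "\<dots> = (\<integral>\<^sup>+ z. ennreal \<sigma> * (F (x + \<sigma> * z) * ennreal (normal_density x \<sigma> (x + \<sigma> * z))) \<partial>lborel)"
    by (rule nn_integral_cmult[symmetric]) measurable
  also have "\<dots> = (\<integral>\<^sup>+ z. ennreal (std_normal_density z) * F (x + \<sigma> * z) \<partial>lborel)"
  proof (rule nn_integral_cong)
    fix z
    have "ennreal \<sigma> * (F (x + \<sigma> * z) * ennreal (normal_density x \<sigma> (x + \<sigma> * z)))
      = (ennreal \<sigma> * ennreal (normal_density x \<sigma> (x + \<sigma> * z))) * F (x + \<sigma> * z)"
      by (simp only: ac_simps)
    also have "ennreal \<sigma> * ennreal (normal_density x \<sigma> (x + \<sigma> * z)) = ennreal (std_normal_density z)"
      using \<open>\<sigma> > 0\<close> by (simp add: ennreal_mult[symmetric] nd)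
    finally show "ennreal \<sigma> * (F (x + \<sigma> * z) * ennreal (normal_density x \<sigma> (x + \<sigma> * z)))
      = ennreal (std_normal_density z) * F (x + \<sigma> * z)" .
  qed
  also have "\<dots> = gauss_avg \<sigma> F x"
    unfolding gauss_avg_def std_gauss_def by (subst nn_integral_density) auto
  finally show ?thesis ..
qed

text \<open>Dominated convergence under the fixed Gaussian measure. The limit \<sigma>0 may be 0,
  which occurs when the boundary is met exactly at the final time.\<close>

lemma gauss_avg_tendsto:
  assumes cont: "continuous_on UNIV g" and nn: "\<And>x. 0 \<le> g x" and bound: "\<And>x. g x \<le> K"
    and x: "x \<longlonglongrightarrow> x0" and \<sigma>: "\<sigma> \<longlonglongrightarrow> \<sigma>0"
  shows "(\<lambda>n. gauss_avg (\<sigma> n) (\<lambda>y. ennreal (g y)) (x n)) \<longlonglongrightarrow> gauss_avg \<sigma>0 (\<lambda>y. ennreal (g y)) x0"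
  unfolding gauss_avg_def
proof (rule nn_integral_dominated_convergence[where w = "\<lambda>_. ennreal K"])
  have [measurable]: "g \<in> borel_measurable borel"
    by (rule borel_measurable_continuous_onI[OF cont])
  show "(\<lambda>z. ennreal (g (x n + \<sigma> n * z))) \<in> borel_measurable std_gauss" for n
    by measurable
  show "(\<lambda>z. ennreal (g (x0 + \<sigma>0 * z))) \<in> borel_measurable std_gauss"
    by measurable
  show "AE z in std_gauss. (\<lambda>n. ennreal (g (x n + \<sigma> n * z))) \<longlonglongrightarrow> ennreal (g (x0 + \<sigma>0 * z))"
  proof (intro AE_I2 tendsto_ennrealI)
    fix z
    have "(\<lambda>n. x n + \<sigma> n * z) \<longlonglongrightarrow> x0 + \<sigma>0 * z"
      by (intro tendsto_intros x \<sigma>)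
    moreover have "isCont g (x0 + \<sigma>0 * z)"
      using cont by (simp add: continuous_on_eq_continuous_at)
    ultimately show "(\<lambda>n. g (x n + \<sigma> n * z)) \<longlonglongrightarrow> g (x0 + \<sigma>0 * z)"
      by (rule isCont_tendsto_compose[rotated])
  qed
qed (auto intro!: ennreal_leI bound)

lemma cylinder_in_sets:
  assumes "finite J" "\<And>j. j \<in> J \<Longrightarrow> V j \<in> borel_measurable N" "\<And>j. A j \<in> sets borel"
  shows "{\<omega> \<in> space N. \<forall>j\<in>J. V j \<omega> \<in> A j} \<in> sets N"
  using assms by (intro sets.sets_Collect_finite_All) (auto intro: measurable_sets_Collect)

section \<open>The natural filtration and the Markov property at fixed times\<close>

context standard_brownian_motion begin

text \<open>The natural filtration of \<open>W\<close>. Finite-dimensional cylinders are taken as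
  generators because they are stable under intersection and each involves only finitely many
  increments.\<close>

definition past :: "real \<Rightarrow> 'a measure" where
  "past s = sigma (space M)
     {{\<omega> \<in> space M. \<forall>j\<in>J. W j \<omega> \<in> A j} | J A. finite J \<and> J \<subseteq> {0..s} \<and> (\<forall>j. A j \<in> sets borel)}"

lemma space_past [simp]: "space (past s) = space M"
  unfolding past_def by (rule space_measure_of) auto

lemma sets_past:
  "sets (past s) = sigma_sets (space M)
     {{\<omega> \<in> space M. \<forall>j\<in>J. W j \<omega> \<in> A j} | J A. finite J \<and> J \<subseteq> {0..s} \<and> (\<forall>j. A j \<in> sets borel)}"
  unfolding past_def by (rule sets_measure_of) auto

lemma subalgebra_past: "subalgebra M (past s)"
  unfolding subalgebra_def sets_past
  by (auto intro!: sets.sigma_sets_subset cylinder_in_sets random_variable)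

lemma W_measurable_past:
  assumes "0 \<le> r" "r \<le> s"
  shows "W r \<in> borel_measurable (past s)"
proof (rule measurableI)
  fix B :: "real set" assume B: "B \<in> sets borel"
  have "W r -` B \<inter> space (past s) = {\<omega> \<in> space M. \<forall>j\<in>{r}. W j \<omega> \<in> (\<lambda>_. B) j}"
    by auto
  also have "\<dots> \<in> sets (past s)"
    unfolding sets_past using assms B by (intro sigma_sets.Basic CollectI exI[of _ "{r}"] exI[of _ "\<lambda>_. B"]) auto
  finally show "W r -` B \<inter> space (past s) \<in> sets (past s)" .
qed auto

text \<open>Along a sorted list of times the values \<open>W j - W 0\<close> are partial sums of
  increments up to \<open>s\<close>, while \<open>W t - W s\<close> is one further increment.
  Disjoint blocks of independent increments are independent.\<close>

lemma indep_cylinder_increment: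
  assumes st: "0 \<le> s" "s < t" and J: "finite J" "J \<subseteq> {0..s}" and A: "\<And>j. A j \<in> sets borel"
    and B: "B \<in> sets borel"
  shows "prob ({\<omega> \<in> space M. \<forall>j\<in>J. W j \<omega> \<in> A j} \<inter> {\<omega> \<in> space M. W t \<omega> - W s \<omega> \<in> B})
       = prob {\<omega> \<in> space M. \<forall>j\<in>J. W j \<omega> \<in> A j} * prob {\<omega> \<in> space M. W t \<omega> - W s \<omega> \<in> B}"
proof -
  \<comment> \<open>With 0 as first time the partial sums telescope to \<open>W j - W 0\<close>;
    with \<open>s\<close> as last time the next increment is exactly
    \<open>W t - W s\<close>.\<close>
  define K where "K = insert 0 (insert s J)"
  have K: "finite K" "K \<subseteq> {0..s}" "0 \<in> K" "s \<in> K" using J st by (auto simp: K_def)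
  define l where "l = sorted_list_of_set K"
  have l: "set l = K" "sorted l" "distinct l" using K by (auto simp: l_def)
  define n where "n = length l - 1"
  have len: "length l = Suc n"
    using l K by (cases l) (auto simp: n_def)
  define T where "T i = (if i \<le> n then l ! i else t)" for i
  have T0: "T 0 = 0"
  proof -
    obtain i where i: "i < length l" "l ! i = 0" using K l by (metis in_set_conv_nth)
    have "l ! 0 \<le> 0" using sorted_nth_mono[OF l(2), of 0 i] i by simp
    moreover have "l ! 0 \<in> K" using l len by (metis nth_mem zero_less_Suc)
    ultimately show ?thesis using K by (force simp: T_def)
  qed
  have Tn: "T n = s"
  proof -
    obtain i where i: "i < length l" "l ! i = s" using K l by (metis in_set_conv_nth)
    have "s \<le> l ! n" using sorted_nth_mono[OF l(2), of i n] i len by simp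
    moreover have "l ! n \<in> K" using l len by (metis nth_mem lessI)
    ultimately show ?thesis using K by (force simp: T_def)
  qed
  have mono: "mono_on {..Suc n} T"
  proof (rule mono_onI)
    fix i j assume ij: "i \<in> {..Suc n}" "j \<in> {..Suc n}" "i \<le> j"
    show "T i \<le> T j"
    proof (cases "j \<le> n")
      case True
      then show ?thesis using ij sorted_nth_mono[OF l(2), of i j] len by (simp add: T_def)
    next
      case False
      have "i \<le> n \<Longrightarrow> l ! i \<in> K" using l len by (metis le_imp_less_Suc nth_mem)
      then show ?thesis using False K st by (force simp: T_def)
    qed
  qed
  have ind: "indep_vars (\<lambda>_. borel) (\<lambda>i \<omega>. W (T (Suc i)) \<omega> - W (T i) \<omega>) {..<Suc n}"
    by (rule indep_increments[OF _ mono]) (simp add: T0)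
  define D where "D = (\<lambda>i \<omega>. W (T (Suc i)) \<omega> - W (T i) \<omega>)"
  have iv: "indep_var (PiM {..<n} (\<lambda>_. borel)) (\<lambda>\<omega>. restrict (\<lambda>i. D i \<omega>) {..<n})
                      (PiM {n} (\<lambda>_. borel)) (\<lambda>\<omega>. restrict (\<lambda>i. D i \<omega>) {n})"
    using indep_var_restrict[OF ind, of "{..<n}" "{n}"] by (auto simp: D_def)
  have idx: "\<exists>k\<le>n. T k = j" if "j \<in> J" for j
  proof -
    have "j \<in> set l" using that l by (simp add: K_def)
    then obtain i where "i < length l" "l ! i = j" by (auto simp: in_set_conv_nth)
    then show ?thesis using len by (intro exI[of _ i]) (auto simp: T_def)
  qed
  then obtain k where k: "\<And>j. j \<in> J \<Longrightarrow> k j \<le> n \<and> T (k j) = j" by metis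
  have sumD: "(\<Sum>i<m. D i \<omega>) = W (T m) \<omega> - W 0 \<omega>" for m \<omega>
    unfolding D_def by (induction m) (auto simp: T0)
  define E where "E = {d \<in> space (PiM {..<n} (\<lambda>_. borel :: real measure)). \<forall>j\<in>J. (\<Sum>i<k j. d i) \<in> A j}"
  define E' where "E' = {d \<in> space (PiM {n} (\<lambda>_. borel :: real measure)). d n \<in> B}"
  have E: "E \<in> sets (PiM {..<n} (\<lambda>_. borel))"
    unfolding E_def
  proof (rule cylinder_in_sets[OF J(1) _ A])
    fix j assume "j \<in> J"
    then have "k j \<le> n" using k by blast
    show "(\<lambda>d. \<Sum>i<k j. d i) \<in> borel_measurable (PiM {..<n} (\<lambda>_. borel :: real measure))"
    proof (rule borel_measurable_sum)
      fix i assume "i \<in> {..<k j}"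
      then have "i \<in> {..<n}" using \<open>k j \<le> n\<close> by simp
      then show "(\<lambda>d. d i) \<in> borel_measurable (PiM {..<n} (\<lambda>_. borel :: real measure))"
        by (rule measurable_component_singleton)
    qed
  qed
  have E': "E' \<in> sets (PiM {n} (\<lambda>_. borel))"
    unfolding E'_def using B by (intro measurable_sets_Collect[OF measurable_component_singleton]) auto
  define C where "C = {\<omega> \<in> space M. \<forall>j\<in>J. W j \<omega> \<in> A j}"
  \<comment> \<open>The increments determine only \<open>W j - W 0\<close>. The event
    \<open>C'\<close> agrees with \<open>C\<close> almost surely, because \<open>W 0\<close>
    vanishes only almost surely.\<close>
  define C' where "C' = {\<omega> \<in> space M. \<forall>j\<in>J. W j \<omega> - W 0 \<omega> \<in> A j}"
  define I where "I = {\<omega> \<in> space M. W t \<omega> - W s \<omega> \<in> B}"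
  have [measurable]: "j \<in> J \<Longrightarrow> W j \<in> borel_measurable M" "W 0 \<in> borel_measurable M"
     "W s \<in> borel_measurable M" "W t \<in> borel_measurable M" for j
    using J st by (auto intro!: random_variable)
  have C: "C \<in> events" unfolding C_def by (rule cylinder_in_sets) (use J A in auto)
  have C': "C' \<in> events" unfolding C'_def by (rule cylinder_in_sets) (use J A in auto)
  have I: "I \<in> events" unfolding I_def using B by measurable
  have DE: "((\<lambda>\<omega>. restrict (\<lambda>i. D i \<omega>) {..<n}) -` E \<inter> space M) = C'"
  proof -
    have "(\<Sum>i<k j. restrict (\<lambda>i. D i \<omega>) {..<n} i) = W j \<omega> - W 0 \<omega>" if "j \<in> J" for j \<omega>
    proof -
      have "(\<Sum>i<k j. restrict (\<lambda>i. D i \<omega>) {..<n} i) = (\<Sum>i<k j. D i \<omega>)"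
        using k[OF that] by (intro sum.cong) auto
      also have "\<dots> = W j \<omega> - W 0 \<omega>" using sumD k[OF that] by simp
      finally show ?thesis .
    qed
    then show ?thesis by (auto simp: E_def C'_def space_PiM)
  qed
  have Dn: "D n = (\<lambda>\<omega>. W t \<omega> - W s \<omega>)" using Tn by (auto simp: D_def T_def)
  have DE': "((\<lambda>\<omega>. restrict (\<lambda>i. D i \<omega>) {n}) -` E' \<inter> space M) = I"
    by (auto simp: E'_def I_def space_PiM Dn)
  have "prob (C' \<inter> I) = prob C' * prob I"
  proof -
    have "C' \<inter> I = (\<lambda>x. (\<lambda>i\<in>{..<n}. D i x, \<lambda>i\<in>{n}. D i x)) -` (E \<times> E') \<inter> space M"
      unfolding DE[symmetric] DE'[symmetric] by blast
    then show ?thesis using indep_varD[OF iv E E'] unfolding DE DE' by simp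
  qed
  moreover have ae: "AE \<omega> in M. \<omega> \<in> C' \<longleftrightarrow> \<omega> \<in> C"
    using start_0 by eventually_elim (auto simp: C_def C'_def)
  have "prob (C' \<inter> I) = prob (C \<inter> I)"
  proof (rule finite_measure_eq_AE)
    show "AE \<omega> in M. \<omega> \<in> C' \<inter> I \<longleftrightarrow> \<omega> \<in> C \<inter> I" using ae by eventually_elim auto
  qed (use C C' I in auto)
  moreover have "prob C' = prob C"
    by (rule finite_measure_eq_AE[OF ae C' C])
  ultimately show ?thesis by (simp add: C_def I_def)
qed

text \<open>Both generating families are stable under intersection, so the product rule for
  cylinders extends to the generated sigma-algebras.\<close>

lemma indep_past_increment:
  assumes st: "0 \<le> s" "s < t"
  shows "indep_set (sets (past s)) {(\<lambda>\<omega>. W t \<omega> - W s \<omega>) -` B \<inter> space M | B. B \<in> sets borel}"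
proof -
  have [measurable]: "W s \<in> borel_measurable M" "W t \<in> borel_measurable M"
    using st by (auto intro!: random_variable)
  define E where "E = {{\<omega> \<in> space M. \<forall>j\<in>J. W j \<omega> \<in> A j} | J A. finite J \<and> J \<subseteq> {0..s} \<and> (\<forall>j. A j \<in> sets (borel :: real measure))}"
  define E' where "E' = {(\<lambda>\<omega>. W t \<omega> - W s \<omega>) -` B \<inter> space M | B. B \<in> sets borel}"
  have "indep_set E E'"
    unfolding indep_sets2_eq
  proof (intro conjI ballI)
    show "E \<subseteq> events"
      unfolding E_def by (auto intro!: cylinder_in_sets random_variable)
    show "E' \<subseteq> events" unfolding E'_def by auto
  next
    fix a c assume "a \<in> E" "c \<in> E'"
    then obtain J A B where *: "a = {\<omega> \<in> space M. \<forall>j\<in>J. W j \<omega> \<in> A j}" "finite J" "J \<subseteq> {0..s}"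
      "\<And>j. A j \<in> sets borel" "B \<in> sets borel" "c = (\<lambda>\<omega>. W t \<omega> - W s \<omega>) -` B \<inter> space M"
      unfolding E_def E'_def by blast
    have c: "c = {\<omega> \<in> space M. W t \<omega> - W s \<omega> \<in> B}" using * by auto
    show "prob (a \<inter> c) = prob a * prob c"
      unfolding *(1) c by (rule indep_cylinder_increment[OF st]) (use * in auto)
  qed
  moreover have "Int_stable E"
  proof (rule Int_stableI)
    fix a c assume "a \<in> E" "c \<in> E"
    then obtain J A J' A' where *: "a = {\<omega> \<in> space M. \<forall>j\<in>J. W j \<omega> \<in> A j}" "finite J" "J \<subseteq> {0..s}"
      "\<And>j. A j \<in> sets borel" "c = {\<omega> \<in> space M. \<forall>j\<in>J'. W j \<omega> \<in> A' j}" "finite J'" "J' \<subseteq> {0..s}"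
      "\<And>j. A' j \<in> sets borel"
      unfolding E_def by blast
    \<comment> \<open>Two cylinders over different index sets are merged over the union; an index
      absent from one of them contributes no constraint there.\<close>
    define A'' where "A'' j = (if j \<in> J then A j else UNIV) \<inter> (if j \<in> J' then A' j else UNIV)" for j
    have A'': "y \<in> A'' j \<longleftrightarrow> (j \<in> J \<longrightarrow> y \<in> A j) \<and> (j \<in> J' \<longrightarrow> y \<in> A' j)" for y j
      by (simp add: A''_def)
    have "a \<inter> c = {\<omega> \<in> space M. \<forall>j\<in>J \<union> J'. W j \<omega> \<in> A'' j}"
      unfolding *(1,5) A'' by blast
    moreover have "\<forall>j. A'' j \<in> sets borel" using *(4,8) by (auto simp: A''_def)
    moreover have "finite (J \<union> J')" "J \<union> J' \<subseteq> {0..s}" using * by auto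
    ultimately show "a \<inter> c \<in> E" unfolding E_def by blast
  qed
  moreover have "Int_stable E'"
  proof (rule Int_stableI)
    fix a c assume "a \<in> E'" "c \<in> E'"
    then obtain B B' where B: "a = (\<lambda>\<omega>. W t \<omega> - W s \<omega>) -` B \<inter> space M" "B \<in> sets borel"
      "c = (\<lambda>\<omega>. W t \<omega> - W s \<omega>) -` B' \<inter> space M" "B' \<in> sets borel"
      unfolding E'_def by blast
    then have "a \<inter> c = (\<lambda>\<omega>. W t \<omega> - W s \<omega>) -` (B \<inter> B') \<inter> space M" by auto
    then show "a \<inter> c \<in> E'" unfolding E'_def using B by blast
  qed
  ultimately have "indep_set (sigma_sets (space M) E) (sigma_sets (space M) E')"
    by (rule indep_set_sigma_sets)
  then show ?thesis
    unfolding sets_past[of s, folded E_def] E'_def[symmetric] indep_sets2_eq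
    using sigma_sets.Basic[of _ E' "space M"] by blast
qed

text \<open>By independence the joint law of the path up to \<open>s\<close> and the increment is a
  product measure, and Fubini integrates out the Gaussian increment. Restricting to an arbitrary
  past event \<open>A\<close> takes the place of conditional expectations.\<close>

lemma markov:
  assumes st: "0 \<le> s" "s \<le> t" and A: "A \<in> sets (past s)" and [measurable]: "F \<in> borel_measurable borel"
  shows "(\<integral>\<^sup>+ \<omega>. F (W t \<omega>) * indicator A \<omega> \<partial>M)
       = (\<integral>\<^sup>+ \<omega>. gauss_avg (sqrt (t - s)) F (W s \<omega>) * indicator A \<omega> \<partial>M)"
proof (cases "s = t")
  case False
  then have "s < t" using st by simp
  define \<Delta> where "\<Delta> = (\<lambda>\<omega>. W t \<omega> - W s \<omega>)"
  have Wt: "W t \<omega> = W s \<omega> + \<Delta> \<omega>" for \<omega> by (simp add: \<Delta>_def)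
  have \<Delta>m [measurable]: "\<Delta> \<in> borel_measurable M"
    unfolding \<Delta>_def using st by (intro borel_measurable_diff random_variable) auto
  \<comment> \<open>The identity, read as a random variable with values in \<open>past s\<close>,
    carries all information up to time \<open>s\<close>; it is the first component of the joint law
    below.\<close>
  have id [measurable]: "(\<lambda>\<omega>. \<omega>) \<in> measurable M (past s)"
    using subalgebra_past[of s] by (auto simp: subalgebra_def measurable_def Int_absorb2 dest: sets.sets_into_space)
  have A' [measurable]: "A \<in> sets (past s)" by fact
  have Ws [measurable]: "W s \<in> borel_measurable (past s)" using st by (intro W_measurable_past) auto
  have dist: "distr M borel \<Delta> = density lborel (normal_density 0 (sqrt (t - s)))"
  proof -
    have "distr M borel \<Delta> = distr M lborel \<Delta>" by (rule distr_cong) auto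
    also have "\<dots> = density lborel (normal_density 0 (sqrt (t - s)))"
      unfolding \<Delta>_def by (rule distributed_distr_eq_density[OF normal_increments[OF st(1) \<open>s < t\<close>]])
    finally show ?thesis .
  qed
  interpret P: prob_space "distr M (past s) (\<lambda>\<omega>. \<omega>)" by (rule prob_space_distr) measurable
  interpret D: prob_space "distr M borel \<Delta>" by (rule prob_space_distr) measurable
  interpret PD: pair_prob_space "distr M (past s) (\<lambda>\<omega>. \<omega>)" "distr M borel \<Delta>" ..
  have joint: "distr M (past s) (\<lambda>\<omega>. \<omega>) \<Otimes>\<^sub>M distr M borel \<Delta> = distr M (past s \<Otimes>\<^sub>M borel) (\<lambda>\<omega>. (\<omega>, \<Delta> \<omega>))"
  proof (rule pair_measure_eqI)
    fix a c assume "a \<in> sets (distr M (past s) (\<lambda>\<omega>. \<omega>))" "c \<in> sets (distr M borel \<Delta>)"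
    then have ac [measurable]: "a \<in> sets (past s)" "c \<in> sets borel" by auto
    have "prob (a \<inter> (\<Delta> -` c \<inter> space M)) = prob a * prob (\<Delta> -` c \<inter> space M)"
      using indep_past_increment[OF st(1) \<open>s < t\<close>] ac unfolding indep_sets2_eq \<Delta>_def by blast
    moreover have "a \<subseteq> space M" using sets.sets_into_space[OF ac(1)] by simp
    moreover from this have "(\<lambda>\<omega>. (\<omega>, \<Delta> \<omega>)) -` (a \<times> c) \<inter> space M = a \<inter> (\<Delta> -` c \<inter> space M)"
      "(\<lambda>\<omega>. \<omega>) -` a \<inter> space M = a"
      by auto
    ultimately show "emeasure (distr M (past s) (\<lambda>\<omega>. \<omega>)) a * emeasure (distr M borel \<Delta>) c =
        emeasure (distr M (past s \<Otimes>\<^sub>M borel) (\<lambda>\<omega>. (\<omega>, \<Delta> \<omega>))) (a \<times> c)"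
      by (simp add: emeasure_distr emeasure_eq_measure ennreal_mult[symmetric])
  qed (auto intro!: P.sigma_finite_measure_axioms D.sigma_finite_measure_axioms cong: sets_pair_measure_cong)
  have "(\<integral>\<^sup>+ \<omega>. F (W t \<omega>) * indicator A \<omega> \<partial>M)
      = (\<integral>\<^sup>+ p. F (W s (fst p) + snd p) * indicator A (fst p) \<partial>distr M (past s \<Otimes>\<^sub>M borel) (\<lambda>\<omega>. (\<omega>, \<Delta> \<omega>)))"
    by (subst nn_integral_distr) (auto simp: Wt)
  also have "\<dots> = (\<integral>\<^sup>+ p. F (W s (fst p) + snd p) * indicator A (fst p) \<partial>(distr M (past s) (\<lambda>\<omega>. \<omega>) \<Otimes>\<^sub>M distr M borel \<Delta>))"
    by (simp add: joint)
  also have "\<dots> = (\<integral>\<^sup>+ \<omega>. (\<integral>\<^sup>+ y. F (W s \<omega> + y) * indicator A \<omega> \<partial>distr M borel \<Delta>) \<partial>distr M (past s) (\<lambda>\<omega>. \<omega>))"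
    by (subst D.nn_integral_fst[symmetric]) auto
  also have "\<dots> = (\<integral>\<^sup>+ \<omega>. (\<integral>\<^sup>+ y. F (W s \<omega> + y) \<partial>distr M borel \<Delta>) * indicator A \<omega> \<partial>distr M (past s) (\<lambda>\<omega>. \<omega>))"
    by (intro nn_integral_cong nn_integral_multc) measurable
  also have "\<dots> = (\<integral>\<^sup>+ \<omega>. gauss_avg (sqrt (t - s)) F (W s \<omega>) * indicator A \<omega> \<partial>distr M (past s) (\<lambda>\<omega>. \<omega>))"
  proof (intro nn_integral_cong arg_cong2[where f = "(*)"] refl)
    fix \<omega>
    have "(\<integral>\<^sup>+ y. F (W s \<omega> + y) \<partial>distr M borel \<Delta>) = gauss_avg (sqrt (t - s)) (\<lambda>y. F (1 * y + W s \<omega>)) 0"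
      unfolding dist using \<open>s < t\<close>
      by (subst gauss_avg_eq_normal_density) (auto simp: nn_integral_density ac_simps)
    also have "\<dots> = gauss_avg (sqrt (t - s)) F (W s \<omega>)"
      by (subst gauss_avg_affine) simp
    finally show "(\<integral>\<^sup>+ y. F (W s \<omega> + y) \<partial>distr M borel \<Delta>) = gauss_avg (sqrt (t - s)) F (W s \<omega>)" .
  qed
  also have "\<dots> = (\<integral>\<^sup>+ \<omega>. gauss_avg (sqrt (t - s)) F (W s \<omega>) * indicator A \<omega> \<partial>M)"
    by (subst nn_integral_distr) auto
  finally show ?thesis .
qed simp

end

section \<open>First-passage events and times\<close>

text \<open>
  The event that a continuous path meets a continuous boundary by time \<open>u\<close>, expressed through
  rational times only.
\<close>

definition rational_hit :: "(real \<Rightarrow> real) \<Rightarrow> (real \<Rightarrow> real) \<Rightarrow> real \<Rightarrow> bool" where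
  "rational_hit w b u \<longleftrightarrow> (\<exists>m::nat. \<forall>k::nat. \<exists>q\<in>\<rat> \<inter> {0<..<u}.
     1 / real (Suc m) < q \<and> w q - b q < 1 / real (Suc k))"

text \<open>Compactness of [1/(m+1), u] turns arbitrarily small gaps at rational times into a
  genuine contact. The bound 1/(m+1) must not depend on \<open>k\<close>: otherwise a gap that
  merely tends to 0 at the origin would count as a contact.\<close>

lemma rational_hit_iff:
  assumes "continuous_on {0<..u} w" "continuous_on {0<..u} b"
  shows "rational_hit w b u \<longleftrightarrow> (\<exists>t\<in>{0<..u}. w t \<le> b t)"
proof
  define d where "d t = w t - b t" for t
  have d: "continuous_on {0<..u} d" unfolding d_def by (intro continuous_intros assms)
  {
    assume "\<exists>t\<in>{0<..u}. w t \<le> b t"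
    then obtain t where t: "0 < t" "t \<le> u" "d t \<le> 0" by (auto simp: d_def)
    obtain m where m: "1 / real (Suc m) < t"
      using reals_Archimedean[OF t(1)] by (auto simp: inverse_eq_divide)
    have "\<exists>q\<in>\<rat> \<inter> {0<..<u}. 1 / real (Suc m) < q \<and> d q < 1 / real (Suc k)" for k
    proof -
      obtain \<delta> where \<delta>: "\<delta> > 0" "\<And>y. y \<in> {0<..u} \<Longrightarrow> dist y t < \<delta> \<Longrightarrow> dist (d y) (d t) < 1 / real (Suc k)"
        using d[unfolded continuous_on_iff, rule_format, of t "1 / real (Suc k)"] t by auto
      \<comment> \<open>\<open>q\<close> is taken to the left of \<open>t\<close>, so that it stays
        below \<open>u\<close> even for a contact at \<open>t = u\<close>.\<close>
      obtain q where q: "q \<in> \<rat>" "max (1 / real (Suc m)) (t - \<delta>) < q" "q < t"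
        using Rats_dense_in_real[of "max (1 / real (Suc m)) (t - \<delta>)" t] m \<delta>(1) by auto
      have "0 < 1 / real (Suc m)" by simp
      then have q0: "0 < q" using q(2) by linarith
      have "dist (d q) (d t) < 1 / real (Suc k)"
        using q q0 t by (intro \<delta>(2)) (auto simp: dist_real_def)
      then have "d q < 1 / real (Suc k)" using t(3) by (simp add: dist_real_def)
      then show ?thesis using q q0 t by (intro bexI[of _ q]) auto
    qed
    then show "rational_hit w b u" unfolding rational_hit_def d_def by blast
  }
  assume "rational_hit w b u"
  then obtain m where m: "\<And>k. \<exists>q\<in>\<rat> \<inter> {0<..<u}. 1 / real (Suc m) < q \<and> d q < 1 / real (Suc k)"
    unfolding rational_hit_def d_def by blast
  define I where "I = {1 / real (Suc m)..u}"
  have sub: "I \<subseteq> {0<..u}"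
  proof
    fix y assume "y \<in> I"
    then have "1 / real (Suc m) \<le> y" "y \<le> u" by (auto simp: I_def)
    moreover have "0 < 1 / real (Suc m)" by simp
    ultimately show "y \<in> {0<..u}" by (metis greaterThanAtMost_iff less_le_trans)
  qed
  have "I \<noteq> {}" using m[of 0] unfolding I_def by auto
  then obtain t where t: "t \<in> I" "\<And>y. y \<in> I \<Longrightarrow> d t \<le> d y"
    using continuous_attains_inf[of I d] continuous_on_subset[OF d sub] by (auto simp: I_def)
  have "d t \<le> 0"
  proof (rule ccontr)
    assume "\<not> d t \<le> 0"
    then obtain k where k: "1 / real (Suc k) < d t"
      using reals_Archimedean[of "d t"] by (auto simp: inverse_eq_divide)
    obtain q where q: "q \<in> \<rat> \<inter> {0<..<u}" "1 / real (Suc m) < q" "d q < 1 / real (Suc k)"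
      using m[of k] by blast
    then have "q \<in> I" unfolding I_def by (simp add: less_imp_le)
    with t(2)[of q] k q show False by simp
  qed
  then show "\<exists>t\<in>{0<..u}. w t \<le> b t" using t(1) sub by (auto simp: d_def)
qed

lemma rational_hit_measurable:
  fixes V :: "real \<Rightarrow> 'a \<Rightarrow> real"
  assumes "\<And>q. q \<in> \<rat> \<Longrightarrow> 0 < q \<Longrightarrow> q < u \<Longrightarrow> V q \<in> borel_measurable N"
  shows "{x \<in> space N. rational_hit (\<lambda>q. V q x) b u} \<in> sets N"
proof -
  have 1: "{x \<in> space N. 1 / real (Suc m) < q \<and> V q x - b q < 1 / real (Suc k)} \<in> sets N"
    if "q \<in> \<rat> \<inter> {0<..<u}" for q m k
  proof -
    have [measurable]: "V q \<in> borel_measurable N" using that by (intro assms) auto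
    show ?thesis by measurable
  qed
  have "countable (\<rat> \<inter> {0<..<u})" by (intro countable_Int1 countable_rat)
  then show ?thesis unfolding rational_hit_def
    by (intro sets.sets_Collect_countable_Ex sets.sets_Collect_countable_All sets.sets_Collect_countable_Ex' 1)
qed

lemma hit_measurable:
  fixes V :: "real \<Rightarrow> 'a \<Rightarrow> real"
  assumes "\<And>q. 0 < q \<Longrightarrow> q < u \<Longrightarrow> V q \<in> borel_measurable N"
    and "\<And>\<omega>. \<omega> \<in> space N \<Longrightarrow> continuous_on {0<..u} (\<lambda>t. V t \<omega>)" "continuous_on {0<..u} b"
  shows "{\<omega> \<in> space N. \<exists>t\<in>{0<..u}. V t \<omega> \<le> b t} \<in> sets N"
proof -
  have "{\<omega> \<in> space N. \<exists>t\<in>{0<..u}. V t \<omega> \<le> b t} = {\<omega> \<in> space N. rational_hit (\<lambda>q. V q \<omega>) b u}"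
    using rational_hit_iff[OF assms(2,3)] by blast
  then show ?thesis using rational_hit_measurable[OF assms(1)] by simp
qed

section \<open>First-passage times of continuous paths\<close>

lemma first_passage_time_nonneg: "0 \<le> first_passage_time W b \<omega>"
  unfolding first_passage_time_def by (rule Inf_greatest) (auto simp: zero_ereal_def)

text \<open>Without a contact in (0,u], the gap at \<open>u\<close> is positive and remains so up to
  some \<open>u + \<delta>\<close> by continuity, which pushes the infimum to at least
  \<open>u + \<delta>\<close>.\<close>

lemma first_passage_time_le_iff:
  assumes "continuous_on {0<..} (\<lambda>t. W t \<omega>)" "continuous_on {0<..} b" "u > 0"
  shows "first_passage_time W b \<omega> \<le> ereal u \<longleftrightarrow> (\<exists>t\<in>{0<..u}. W t \<omega> \<le> b t)"
proof
  define d where "d t = W t \<omega> - b t" for t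
  have d: "continuous_on {0<..} d" unfolding d_def by (intro continuous_intros assms)
  show "\<exists>t\<in>{0<..u}. W t \<omega> \<le> b t" if le: "first_passage_time W b \<omega> \<le> ereal u"
  proof (rule ccontr)
    assume "\<not> ?thesis"
    then have pos: "d t > 0" if "0 < t" "t \<le> u" for t using that by (auto simp: d_def not_le)
    obtain \<delta> where \<delta>: "\<delta> > 0" "\<And>y. y \<in> {0<..} \<Longrightarrow> dist y u < \<delta> \<Longrightarrow> dist (d y) (d u) < d u"
      using d[unfolded continuous_on_iff, rule_format, of u "d u"] pos[of u] \<open>u > 0\<close> by auto
    have "ereal (u + \<delta>) \<le> first_passage_time W b \<omega>"
      unfolding first_passage_time_def
    proof (rule Inf_greatest, clarsimp)
      fix t assume t: "0 < t" "W t \<omega> \<le> b t"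
      then have dt: "d t \<le> 0" by (simp add: d_def)
      then have "t > u" using pos[of t] t by force
      then show "u + \<delta> \<le> t" using \<delta>(2)[of t] t dt by (force simp: dist_real_def)
    qed
    then have "ereal (u + \<delta>) \<le> ereal u" using le by (rule order_trans)
    then show False using \<delta>(1) by simp
  qed
  assume "\<exists>t\<in>{0<..u}. W t \<omega> \<le> b t"
  then obtain t where t: "0 < t" "t \<le> u" "W t \<omega> \<le> b t" by auto
  have "first_passage_time W b \<omega> \<le> ereal t"
    unfolding first_passage_time_def using t by (intro Inf_lower) auto
  also have "\<dots> \<le> ereal u" using t by simp
  finally show "first_passage_time W b \<omega> \<le> ereal u" .
qed

text \<open>The infimum is attained, and a strict undershoot at \<open>r\<close> would by continuity
  already be a contact slightly earlier. This is what makes the position at the passage time a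
  function of that time.\<close>

lemma first_passage_time_value:
  assumes "continuous_on {0<..} (\<lambda>t. W t \<omega>)" "continuous_on {0<..} b"
    and r: "first_passage_time W b \<omega> = ereal r" "r > 0"
  shows "W r \<omega> = b r"
proof -
  define d where "d t = W t \<omega> - b t" for t
  have d: "continuous_on {0<..} d" unfolding d_def by (intro continuous_intros assms)
  have ge: "r \<le> t" if "0 < t" "d t \<le> 0" for t
  proof -
    have "first_passage_time W b \<omega> \<le> ereal t"
      unfolding first_passage_time_def using that by (intro Inf_lower) (auto simp: d_def)
    then show ?thesis using r by simp
  qed
  obtain t where t: "0 < t" "t \<le> r" "d t \<le> 0"
    using first_passage_time_le_iff[where W = W and \<omega> = \<omega> and b = b and u = r, OF assms(1,2) r(2)] r(1) by (auto simp: d_def)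
  then have "d r \<le> 0" using ge[of t] by simp
  moreover have "\<not> d r < 0"
  proof
    assume neg: "d r < 0"
    obtain \<delta> where \<delta>: "\<delta> > 0" "\<And>y. y \<in> {0<..} \<Longrightarrow> dist y r < \<delta> \<Longrightarrow> dist (d y) (d r) < - d r"
      using d[unfolded continuous_on_iff, rule_format, of r "- d r"] neg r(2) by auto
    \<comment> \<open>The entry \<open>r / 2\<close> keeps \<open>y\<close> positive when \<delta>
      is large.\<close>
    define y where "y = max (r / 2) (r - \<delta> / 2)"
    have y: "0 < y" "y < r" "dist y r < \<delta>"
      using r(2) \<delta>(1) by (auto simp: y_def dist_real_def max_def abs_if)
    then have "d y \<le> 0" using \<delta>(2)[of y] by (auto simp: dist_real_def)
    with ge[of y] y show False by simp
  qed
  ultimately show ?thesis by (simp add: d_def)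
qed

text \<open>A contact strictly before \<open>y\<close> occurs by some rational time below
  \<open>y\<close>. This also covers paths with passage time 0, whose contacts accumulate at the
  origin.\<close>

lemma first_passage_time_measurable:
  assumes "\<And>t. 0 < t \<Longrightarrow> W t \<in> borel_measurable N"
    and "\<And>\<omega>. \<omega> \<in> space N \<Longrightarrow> continuous_on {0<..} (\<lambda>t. W t \<omega>)" "continuous_on {0<..} b"
  shows "first_passage_time W b \<in> borel_measurable N"
proof (rule borel_measurableI_less)
  fix y :: ereal
  have eq: "first_passage_time W b \<omega> < y \<longleftrightarrow> (\<exists>q\<in>{q\<in>\<rat>. 0 < q \<and> ereal q < y}. \<exists>t\<in>{0<..q}. W t \<omega> \<le> b t)" for \<omega>
  proof
    assume "first_passage_time W b \<omega> < y"
    then obtain t where t: "0 < t" "W t \<omega> \<le> b t" "ereal t < y"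
      unfolding first_passage_time_def Inf_less_iff by auto
    obtain r where r: "ereal t < ereal r" "ereal r < y" using ereal_dense2[OF t(3)] by auto
    then obtain q where q: "q \<in> \<rat>" "t < q" "q < r" using Rats_dense_in_real[of t r] by auto
    have "ereal q < y" using q(3) r(2) by (metis ereal_less_eq(3) less_le_not_le order_le_less_trans)
    then show "\<exists>q\<in>{q\<in>\<rat>. 0 < q \<and> ereal q < y}. \<exists>t\<in>{0<..q}. W t \<omega> \<le> b t"
      using q t by (intro bexI[of _ q] bexI[of _ t]) auto
  next
    assume "\<exists>q\<in>{q\<in>\<rat>. 0 < q \<and> ereal q < y}. \<exists>t\<in>{0<..q}. W t \<omega> \<le> b t"
    then obtain q t where "ereal q < y" "0 < t" "t \<le> q" "W t \<omega> \<le> b t" by auto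
    moreover have "first_passage_time W b \<omega> \<le> ereal t"
      unfolding first_passage_time_def using calculation by (intro Inf_lower) auto
    ultimately show "first_passage_time W b \<omega> < y"
      by (meson ereal_less_eq(3) order_le_less_trans)
  qed
  have "countable {q\<in>\<rat>. 0 < q \<and> ereal q < y}"
    by (rule countable_subset[OF _ countable_rat]) auto
  then show "{\<omega> \<in> space N. first_passage_time W b \<omega> < y} \<in> sets N"
    unfolding eq
  proof (rule sets.sets_Collect_countable_Ex'[rotated])
    fix q assume "q \<in> {q \<in> \<rat>. 0 < q \<and> ereal q < y}"
    show "{\<omega> \<in> space N. \<exists>t\<in>{0<..q}. W t \<omega> \<le> b t} \<in> sets N"
    proof (rule hit_measurable)
      show "continuous_on {0<..q} (\<lambda>t. W t \<omega>)" if "\<omega> \<in> space N" for \<omega>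
        by (rule continuous_on_subset[OF assms(2)[OF that]]) auto
      show "continuous_on {0<..q} b"
        by (rule continuous_on_subset[OF assms(3)]) auto
    qed (use assms(1) in auto)
  qed
qed

text \<open>The law of a random time restricted to \<open>(-\<infinity>,\<infinity>)\<close>: the mass at infinity is dropped.\<close>

definition finite_law :: "'a measure \<Rightarrow> ('a \<Rightarrow> ereal) \<Rightarrow> real measure" where
  "finite_law M \<tau> = distr (density M (indicator {\<omega> \<in> space M. \<tau> \<omega> \<noteq> \<infinity>})) borel (\<lambda>\<omega>. real_of_ereal (\<tau> \<omega>))"

lemma sets_finite_law [simp]: "sets (finite_law M \<tau>) = sets borel"
  by (simp add: finite_law_def)

text \<open>\<open>real_of_ereal\<close> sends infinity to 0, so without the indicator in
  \<open>finite_law\<close> the paths that never meet the boundary would form an atom at 0.\<close>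

lemma emeasure_finite_law:
  assumes [measurable]: "\<tau> \<in> borel_measurable M" and nn: "\<And>\<omega>. 0 \<le> \<tau> \<omega>" and [measurable]: "A \<in> sets borel"
  shows "emeasure (finite_law M \<tau>) A = emeasure M {\<omega> \<in> space M. \<tau> \<omega> \<in> ereal ` A}"
proof -
  have "emeasure (finite_law M \<tau>) A
      = (\<integral>\<^sup>+ \<omega>. indicator {\<omega> \<in> space M. \<tau> \<omega> \<noteq> \<infinity>} \<omega> * indicator ((\<lambda>\<omega>. real_of_ereal (\<tau> \<omega>)) -` A \<inter> space M) \<omega> \<partial>M)"
    unfolding finite_law_def by (simp add: emeasure_distr emeasure_density)
  also have "\<dots> = (\<integral>\<^sup>+ \<omega>. indicator ({\<omega> \<in> space M. \<tau> \<omega> \<noteq> \<infinity>} \<inter> ((\<lambda>\<omega>. real_of_ereal (\<tau> \<omega>)) -` A \<inter> space M)) \<omega> \<partial>M)"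
    by (intro nn_integral_cong) (simp split: split_indicator)
  also have "\<dots> = emeasure M ({\<omega> \<in> space M. \<tau> \<omega> \<noteq> \<infinity>} \<inter> ((\<lambda>\<omega>. real_of_ereal (\<tau> \<omega>)) -` A \<inter> space M))"
    by (rule nn_integral_indicator) measurable
  also have "{\<omega> \<in> space M. \<tau> \<omega> \<noteq> \<infinity>} \<inter> ((\<lambda>\<omega>. real_of_ereal (\<tau> \<omega>)) -` A \<inter> space M) = {\<omega> \<in> space M. \<tau> \<omega> \<in> ereal ` A}"
  proof (intro set_eqI)
    fix \<omega>
    show "\<omega> \<in> {\<omega> \<in> space M. \<tau> \<omega> \<noteq> \<infinity>} \<inter> ((\<lambda>\<omega>. real_of_ereal (\<tau> \<omega>)) -` A \<inter> space M)
      \<longleftrightarrow> \<omega> \<in> {\<omega> \<in> space M. \<tau> \<omega> \<in> ereal ` A}"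
      using nn[of \<omega>] by (cases "\<tau> \<omega>") auto
  qed
  finally show ?thesis .
qed

text \<open>\<open>f\<close> is arbitrary on the nonpositive reals, so measurability is available
  only after multiplication by the indicator.\<close>

lemma measurable_density_on_pos:
  fixes f :: "real \<Rightarrow> real"
  assumes "continuous_on {0<..} f"
  shows "(\<lambda>t. ennreal (f t) * indicator {0<..} t) \<in> borel_measurable borel"
proof -
  have "(\<lambda>t. ennreal (indicator {0<..} t *\<^sub>R f t)) \<in> borel_measurable borel"
    using borel_measurable_continuous_on_indicator[OF _ assms] by measurable
  also have "(\<lambda>t. ennreal (indicator {0<..} t *\<^sub>R f t)) = (\<lambda>t. ennreal (f t) * indicator {0<..} t)"
    by (auto split: split_indicator)
  finally show ?thesis .
qed

lemma has_continuous_density_iff_finite_law: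
  assumes \<tau>: "\<tau> \<in> borel_measurable M" and nn: "\<And>\<omega>. 0 \<le> \<tau> \<omega>"
    and f: "continuous_on {0<..} f" "\<And>t. t > 0 \<Longrightarrow> 0 \<le> f t"
  shows "has_continuous_density M \<tau> f \<longleftrightarrow>
    finite_law M \<tau> = density lborel (\<lambda>t. ennreal (f t) * indicator {0<..} t)"
proof -
  note m = measurable_density_on_pos[OF f(1)]
  have em: "emeasure (density lborel (\<lambda>t. ennreal (f t) * indicator {0<..} t)) A
      = (\<integral>\<^sup>+ t \<in> A \<inter> {0<..}. ennreal (f t) \<partial>lborel)" if "A \<in> sets borel" for A
    using that m by (subst emeasure_density) (auto intro!: nn_integral_cong split: split_indicator)
  show ?thesis
    unfolding has_continuous_density_def using assms
    by (auto simp: em emeasure_finite_law[OF \<tau> nn, symmetric] intro!: measure_eqI)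
qed

section \<open>Optional stopping at a boundary\<close>

context standard_brownian_motion begin

lemma continuous_paths_pos: "\<omega> \<in> space M \<Longrightarrow> continuous_on {0<..} (\<lambda>t. W t \<omega>)"
  by (rule continuous_on_subset[OF continuous_paths]) auto

abbreviation hits :: "(real \<Rightarrow> real) \<Rightarrow> real \<Rightarrow> 'a set" where
  "hits b u \<equiv> {\<omega> \<in> space M. \<exists>t\<in>{0<..u}. W t \<omega> \<le> b t}"

lemma hits_past:
  assumes "continuous_on {0<..} b"
  shows "hits b u \<in> sets (past u)"
proof -
  have "{\<omega> \<in> space (past u). \<exists>t\<in>{0<..u}. W t \<omega> \<le> b t} \<in> sets (past u)"
  proof (rule hit_measurable)
    show "continuous_on {0<..u} (\<lambda>t. W t \<omega>)" if "\<omega> \<in> space (past u)" for \<omega>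
      using that by (intro continuous_on_subset[OF continuous_paths_pos]) auto
    show "continuous_on {0<..u} b"
      by (rule continuous_on_subset[OF assms]) auto
  qed (auto intro!: W_measurable_past)
  then show ?thesis by simp
qed

lemma sets_past_mono: "s \<le> t \<Longrightarrow> sets (past s) \<subseteq> sets (past t)"
  unfolding sets_past
proof (rule sigma_sets_mono', rule subsetI, elim CollectE exE conjE)
  fix a J A
  assume "s \<le> t" and a: "a = {\<omega> \<in> space M. \<forall>j\<in>J. W j \<omega> \<in> A j}" "finite J" "\<forall>j. A j \<in> sets borel"
    and "J \<subseteq> {0..s}"
  then have "J \<subseteq> {0..t}" by auto
  with a show "a \<in> {{\<omega> \<in> space M. \<forall>j\<in>J. W j \<omega> \<in> A j} |J A.
      finite J \<and> J \<subseteq> {0..t} \<and> (\<forall>j. A j \<in> sets borel)}" by blast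
qed

lemma hits_sets: "continuous_on {0<..} b \<Longrightarrow> hits b u \<in> sets M"
  using hits_past subalgebra_past unfolding subalgebra_def by blast

lemma first_passage_time_rv:
  "continuous_on {0<..} b \<Longrightarrow> first_passage_time W b \<in> borel_measurable M"
  by (rule first_passage_time_measurable) (auto intro: random_variable continuous_paths_pos)

lemma in_hits_iff:
  assumes "continuous_on {0<..} b" "\<omega> \<in> space M" "u > 0"
  shows "\<omega> \<in> hits b u \<longleftrightarrow> first_passage_time W b \<omega> \<le> ereal u"
  using first_passage_time_le_iff[where W = W and \<omega> = \<omega> and b = b and u = u,
      OF continuous_paths_pos[OF assms(2)] assms(1,3)] assms(2) by simp

text \<open>
  Optional stopping for the hitting time rounded up to the grid \<open>k u / (n + 1)\<close>: on the event that the
  boundary is first met in the \<open>k\<close>-th cell, \<open>g (W u)\<close> is averaged over the path after that cell.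
\<close>

definition grid_avg :: "(real \<Rightarrow> real) \<Rightarrow> (real \<Rightarrow> real) \<Rightarrow> real \<Rightarrow> nat \<Rightarrow> 'a \<Rightarrow> ennreal" where
  "grid_avg b g u n \<omega> = (\<Sum>k<Suc n.
     gauss_avg (sqrt (u - u * real (Suc k) / real (Suc n))) (\<lambda>y. ennreal (g y)) (W (u * real (Suc k) / real (Suc n)) \<omega>)
     * indicator (hits b (u * real (Suc k) / real (Suc n)) - hits b (u * real k / real (Suc n))) \<omega>)"

text \<open>The event that the first contact lies in a given cell belongs to the past of the right
  end of that cell. On it the Markov property replaces \<open>g (W u)\<close> by its Gaussian
  average, and the cells partition \<open>hits b u\<close>.\<close>

lemma nn_integral_grid_avg:
  assumes b: "continuous_on {0<..} b" and [measurable]: "g \<in> borel_measurable borel" and u: "u > 0"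
  shows "(\<integral>\<^sup>+ \<omega>. grid_avg b g u n \<omega> \<partial>M) = (\<integral>\<^sup>+ \<omega>. ennreal (g (W u \<omega>)) * indicator (hits b u) \<omega> \<partial>M)"
proof -
  define T where "T k = u * real k / real (Suc n)" for k
  have T: "0 \<le> T k" for k using u by (simp add: T_def)
  have Tu: "T (Suc n) = u" by (simp add: T_def)
  have Tm: "T j \<le> T k" if "j \<le> k" for j k
    using that u by (auto simp: T_def intro!: divide_right_mono mult_left_mono)
  have [measurable]: "hits b v \<in> sets M" for v by (rule hits_sets[OF b])
  have [measurable]: "W (T k) \<in> borel_measurable M" "W u \<in> borel_measurable M" for k
    using T u by (auto intro: random_variable)
  define E where "E k = hits b (T (Suc k)) - hits b (T k)" for k
  have [measurable]: "E k \<in> sets M" for k unfolding E_def by measurable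
  have mono: "hits b v \<subseteq> hits b w" if "v \<le> w" for v w using that by force
  have Ep: "E k \<in> sets (past (T (Suc k)))" for k
    unfolding E_def using hits_past[OF b] sets_past_mono[OF Tm[of k "Suc k"]]
    by (intro sets.Diff) auto
  \<comment> \<open>A telescoping sum that starts at 0, because \<open>T 0 = 0\<close> and the
    interval {0<..0} is empty.\<close>
  have ind: "(\<Sum>k<m. indicator (E k) \<omega> :: ennreal) = indicator (hits b (T m)) \<omega>" for m \<omega>
  proof (induction m)
    case 0
    then show ?case by (simp add: T_def)
  next
    case (Suc m)
    have "hits b (T m) \<subseteq> hits b (T (Suc m))" by (intro mono Tm) auto
    then show ?case using Suc by (auto simp: E_def split: split_indicator)
  qed
  have "(\<integral>\<^sup>+ \<omega>. ennreal (g (W u \<omega>)) * indicator (hits b u) \<omega> \<partial>M)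
      = (\<integral>\<^sup>+ \<omega>. (\<Sum>k<Suc n. ennreal (g (W u \<omega>)) * indicator (E k) \<omega>) \<partial>M)"
    by (simp only: sum_distrib_left[symmetric] ind Tu)
  also have "\<dots> = (\<Sum>k<Suc n. \<integral>\<^sup>+ \<omega>. ennreal (g (W u \<omega>)) * indicator (E k) \<omega> \<partial>M)"
    by (rule nn_integral_sum) measurable
  also have "\<dots> = (\<Sum>k<Suc n. \<integral>\<^sup>+ \<omega>. gauss_avg (sqrt (u - T (Suc k))) (\<lambda>y. ennreal (g y)) (W (T (Suc k)) \<omega>) * indicator (E k) \<omega> \<partial>M)"
  proof (rule sum.cong[OF refl])
    fix k assume "k \<in> {..<Suc n}"
    then have "T (Suc k) \<le> u" using Tm[of "Suc k" "Suc n"] Tu by auto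
    then show "(\<integral>\<^sup>+ \<omega>. ennreal (g (W u \<omega>)) * indicator (E k) \<omega> \<partial>M)
      = (\<integral>\<^sup>+ \<omega>. gauss_avg (sqrt (u - T (Suc k))) (\<lambda>y. ennreal (g y)) (W (T (Suc k)) \<omega>) * indicator (E k) \<omega> \<partial>M)"
      by (intro markov[OF T _ Ep]) auto
  qed
  also have "\<dots> = (\<integral>\<^sup>+ \<omega>. (\<Sum>k<Suc n. gauss_avg (sqrt (u - T (Suc k))) (\<lambda>y. ennreal (g y)) (W (T (Suc k)) \<omega>) * indicator (E k) \<omega>) \<partial>M)"
    by (rule nn_integral_sum[symmetric]) measurable
  also have "\<dots> = (\<integral>\<^sup>+ \<omega>. grid_avg b g u n \<omega> \<partial>M)"
    unfolding grid_avg_def E_def T_def ..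
  finally show ?thesis ..
qed

text \<open>Exactly one cell contains the first contact time \<open>r\<close>, so one summand
  survives; \<rho> is the right end of that cell, less than one mesh width after
  \<open>r\<close>.\<close>

lemma grid_avg_eq:
  assumes b: "continuous_on {0<..} b" and u: "u > 0" and \<omega>: "\<omega> \<in> space M"
    and r: "first_passage_time W b \<omega> = ereal r" "0 < r" "r \<le> u"
  shows "\<exists>\<rho>. r \<le> \<rho> \<and> \<rho> \<le> r + u / real (Suc n) \<and> \<rho> \<le> u \<and>
    grid_avg b g u n \<omega> = gauss_avg (sqrt (u - \<rho>)) (\<lambda>y. ennreal (g y)) (W \<rho> \<omega>)"
proof -
  define T where "T k = u * real k / real (Suc n)" for k
  have Tu: "T (Suc n) = u" and T0: "T 0 = 0" by (simp_all add: T_def)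
  have Tm: "T j \<le> T k" if "j \<le> k" for j k
    using that u by (auto simp: T_def intro!: divide_right_mono mult_left_mono)
  have TS: "T (Suc k) = T k + u / real (Suc n)" for k
  proof -
    have "u * real (Suc k) = u * real k + u" by (simp add: algebra_simps)
    then show ?thesis unfolding T_def by (simp only: add_divide_distrib)
  qed
  have hit: "\<omega> \<in> hits b (T k) \<longleftrightarrow> r \<le> T k" for k
  proof (cases "T k > 0")
    case True
    show ?thesis unfolding in_hits_iff[OF b \<omega> True] r(1) by simp
  next
    case False
    then have "\<omega> \<notin> hits b (T k)" by simp
    then show ?thesis using r(2) False by simp
  qed
  have rn: "r \<le> T (Suc n)" using r(3) Tu by linarith
  define k where "k = (LEAST k. r \<le> T k)"
  have k: "r \<le> T k" unfolding k_def by (rule LeastI[of "\<lambda>k. r \<le> T k", OF rn])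
  have least: "k \<le> i" if "r \<le> T i" for i
    unfolding k_def by (rule Least_le[of "\<lambda>k. r \<le> T k", OF that])
  have kn: "k \<le> Suc n" by (rule least[OF rn])
  have "k \<noteq> 0"
  proof
    assume "k = 0"
    then show False using k T0 r(2) by simp
  qed
  then obtain j where j: "k = Suc j" by (cases k) auto
  have jr: "T j < r"
  proof (rule ccontr)
    assume "\<not> T j < r"
    then have "Suc j \<le> j" using least[of j] j by simp
    then show False by simp
  qed
  have ind: "indicator (hits b (T (Suc i)) - hits b (T i)) \<omega> = (if i = j then 1 else 0 :: ennreal)" for i
  proof -
    have "\<omega> \<in> hits b (T (Suc i)) - hits b (T i) \<longleftrightarrow> r \<le> T (Suc i) \<and> \<not> r \<le> T i"
      using hit by blast
    also have "\<dots> \<longleftrightarrow> i = j"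
    proof
      assume *: "r \<le> T (Suc i) \<and> \<not> r \<le> T i"
      have "\<not> Suc i \<le> j" using Tm[of "Suc i" j] * jr by auto
      moreover have "\<not> Suc j \<le> i" using Tm[of "Suc j" i] * k j by auto
      ultimately show "i = j" by simp
    qed (use k j jr in auto)
    finally show ?thesis by (simp add: indicator_def)
  qed
  have "grid_avg b g u n \<omega> = (\<Sum>i<Suc n. gauss_avg (sqrt (u - T (Suc i))) (\<lambda>y. ennreal (g y)) (W (T (Suc i)) \<omega>)
      * (if i = j then 1 else 0))"
    unfolding grid_avg_def T_def[symmetric] ind ..
  also have "\<dots> = gauss_avg (sqrt (u - T (Suc j))) (\<lambda>y. ennreal (g y)) (W (T (Suc j)) \<omega>)"
    using kn j by (subst sum.remove[of _ j]) (auto intro!: sum.neutral)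
  finally show ?thesis
    using k j jr TS[of j] Tm[OF kn] Tu by (intro exI[of _ "T (Suc j)"]) auto
qed

lemma grid_avg_outside:
  assumes "\<omega> \<notin> hits b u" "u > 0"
  shows "grid_avg b g u n \<omega> = 0"
proof -
  define T where "T k = u * real k / real (Suc n)" for k
  have "\<omega> \<notin> hits b (T (Suc k))" if "k < Suc n" for k
  proof -
    have "real (Suc k) / real (Suc n) \<le> 1" using that by simp
    then have "T (Suc k) \<le> u"
      using mult_left_mono[of "real (Suc k) / real (Suc n)" 1 u] assms(2) by (simp add: T_def)
    then have "{0<..T (Suc k)} \<subseteq> {0<..u}" by auto
    then show ?thesis using assms(1) by blast
  qed
  then show ?thesis
    unfolding grid_avg_def T_def[symmetric] by (intro sum.neutral ballI) (simp add: indicator_def)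
qed

text \<open>The expectation of \<open>grid_avg\<close> does not depend on the mesh, while its
  integrand converges pathwise as the mesh shrinks: the rounded times decrease to the contact time
  and path continuity gives the limit position \<open>b (\<tau> \<omega>)\<close>. The constant
  \<open>K\<close> dominates. Passage time 0 has to be excluded because such paths have no first
  contact point.\<close>

lemma optional_stopping_bounded:
  assumes b: "continuous_on {0<..} b" "b \<in> borel_measurable borel"
    and g: "continuous_on UNIV g" "\<And>x. 0 \<le> g x" "\<And>x. g x \<le> K" and u: "u > 0"
    and pos: "AE \<omega> in M. first_passage_time W b \<omega> \<noteq> 0"
  defines "\<tau> \<equiv> \<lambda>\<omega>. real_of_ereal (first_passage_time W b \<omega>)"
  shows "(\<integral>\<^sup>+ \<omega>. ennreal (g (W u \<omega>)) * indicator (hits b u) \<omega> \<partial>M)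
       = (\<integral>\<^sup>+ \<omega>. gauss_avg (sqrt (u - \<tau> \<omega>)) (\<lambda>y. ennreal (g y)) (b (\<tau> \<omega>)) * indicator (hits b u) \<omega> \<partial>M)"
proof -
  note [measurable] = first_passage_time_rv[OF b(1)] b(2)
  have gm [measurable]: "g \<in> borel_measurable borel" by (rule borel_measurable_continuous_onI[OF g(1)])
  have [measurable]: "hits b v \<in> sets M" for v by (rule hits_sets[OF b(1)])
  have \<tau>m [measurable]: "\<tau> \<in> borel_measurable M" unfolding \<tau>_def by measurable
  define L where "L \<omega> = gauss_avg (sqrt (u - \<tau> \<omega>)) (\<lambda>y. ennreal (g y)) (b (\<tau> \<omega>)) * indicator (hits b u) \<omega>" for \<omega>
  have avg_le: "gauss_avg \<sigma> (\<lambda>y. ennreal (g y)) x \<le> ennreal K" for \<sigma> x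
  proof -
    have "gauss_avg \<sigma> (\<lambda>y. ennreal (g y)) x \<le> gauss_avg \<sigma> (\<lambda>_. ennreal K) x"
      unfolding gauss_avg_def by (intro nn_integral_mono ennreal_leI g)
    then show ?thesis by simp
  qed
  have rep: "\<exists>r. first_passage_time W b \<omega> = ereal r \<and> 0 < r \<and> r \<le> u \<and> \<tau> \<omega> = r"
    if "\<omega> \<in> hits b u" "first_passage_time W b \<omega> \<noteq> 0" for \<omega>
  proof -
    have \<omega>: "\<omega> \<in> space M" using that(1) by simp
    have "first_passage_time W b \<omega> \<le> ereal u" by (rule in_hits_iff[OF b(1) \<omega> u, THEN iffD1, OF that(1)])
    then show ?thesis using first_passage_time_nonneg[of W b \<omega>] that(2)
      by (cases "first_passage_time W b \<omega>") (auto simp: \<tau>_def zero_ereal_def)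
  qed
  have "(\<lambda>n. \<integral>\<^sup>+ \<omega>. grid_avg b g u n \<omega> \<partial>M) \<longlonglongrightarrow> (\<integral>\<^sup>+ \<omega>. L \<omega> \<partial>M)"
  proof (rule nn_integral_dominated_convergence[where w = "\<lambda>_. ennreal K"])
    show "grid_avg b g u n \<in> borel_measurable M" for n
    proof -
      have [measurable]: "W (u * real (Suc k) / real (Suc n)) \<in> borel_measurable M" for k
        using u by (intro random_variable) simp
      show ?thesis unfolding grid_avg_def by measurable
    qed
    show "L \<in> borel_measurable M" unfolding L_def by measurable
    show "(\<integral>\<^sup>+ \<omega>. ennreal K \<partial>M) < \<infinity>" by (simp add: emeasure_space_1)
    show "AE \<omega> in M. grid_avg b g u n \<omega> \<le> ennreal K" for n
      using pos AE_space
    proof eventually_elim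
      case (elim \<omega>)
      show ?case
      proof (cases "\<omega> \<in> hits b u")
        case True
        then obtain r where r: "first_passage_time W b \<omega> = ereal r" "0 < r" "r \<le> u"
          using rep[OF True elim(1)] by auto
        show ?thesis using grid_avg_eq[OF b(1) u elim(2) r, of n g] avg_le by auto
      qed (simp add: grid_avg_outside u)
    qed
    show "AE \<omega> in M. (\<lambda>n. grid_avg b g u n \<omega>) \<longlonglongrightarrow> L \<omega>"
      using pos AE_space
    proof eventually_elim
      case (elim \<omega>)
      show ?case
      proof (cases "\<omega> \<in> hits b u")
        case True
        then obtain r where r: "first_passage_time W b \<omega> = ereal r" "0 < r" "r \<le> u" and \<tau>r: "\<tau> \<omega> = r"
          using rep[OF True elim(1)] by auto
        define \<rho> where "\<rho> n = (SOME \<rho>. r \<le> \<rho> \<and> \<rho> \<le> r + u / real (Suc n) \<and> \<rho> \<le> u \<and>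
           grid_avg b g u n \<omega> = gauss_avg (sqrt (u - \<rho>)) (\<lambda>y. ennreal (g y)) (W \<rho> \<omega>))" for n
        have \<rho>: "r \<le> \<rho> n \<and> \<rho> n \<le> r + u / real (Suc n) \<and> \<rho> n \<le> u \<and>
           grid_avg b g u n \<omega> = gauss_avg (sqrt (u - \<rho> n)) (\<lambda>y. ennreal (g y)) (W (\<rho> n) \<omega>)" for n
          unfolding \<rho>_def by (rule someI_ex[OF grid_avg_eq[OF b(1) u elim(2) r]])
        have \<rho>lo: "r \<le> \<rho> n" and \<rho>hi: "\<rho> n \<le> r + u / real (Suc n)"
          and grid: "grid_avg b g u n \<omega> = gauss_avg (sqrt (u - \<rho> n)) (\<lambda>y. ennreal (g y)) (W (\<rho> n) \<omega>)" for n
          using \<rho>[of n] by simp_all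
        have "(\<lambda>n. r + u / real (Suc n)) \<longlonglongrightarrow> r + 0"
          by (intro tendsto_add tendsto_const LIMSEQ_Suc[OF lim_const_over_n])
        then have hi: "(\<lambda>n. r + u / real (Suc n)) \<longlonglongrightarrow> r" by simp
        have \<rho>lim: "\<rho> \<longlonglongrightarrow> r"
          by (rule tendsto_sandwich[OF always_eventually always_eventually tendsto_const hi]) (simp_all only: \<rho>lo \<rho>hi simp_thms)
        have "isCont (\<lambda>t. W t \<omega>) r"
          using continuous_paths_pos[OF elim(2)] r(2)
          by (simp add: continuous_on_eq_continuous_at[OF open_greaterThan])
        then have "(\<lambda>n. W (\<rho> n) \<omega>) \<longlonglongrightarrow> W r \<omega>"
          using \<rho>lim by (rule isCont_tendsto_compose)
        moreover have "W r \<omega> = b r"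
          by (rule first_passage_time_value[where W = W and \<omega> = \<omega> and b = b,
                OF continuous_paths_pos[OF elim(2)] b(1) r(1,2)])
        ultimately have "(\<lambda>n. gauss_avg (sqrt (u - \<rho> n)) (\<lambda>y. ennreal (g y)) (W (\<rho> n) \<omega>))
           \<longlonglongrightarrow> gauss_avg (sqrt (u - r)) (\<lambda>y. ennreal (g y)) (b r)"
          by (intro gauss_avg_tendsto[OF g] tendsto_intros \<rho>lim) simp
        then show ?thesis using True by (simp add: grid L_def \<tau>r)
      next
        case False
        then have "L \<omega> = 0" by (simp add: L_def)
        then show ?thesis using False by (simp add: grid_avg_outside u)
      qed
    qed
  qed measurable
  then have "(\<lambda>n::nat. \<integral>\<^sup>+ \<omega>. ennreal (g (W u \<omega>)) * indicator (hits b u) \<omega> \<partial>M) \<longlonglongrightarrow> (\<integral>\<^sup>+ \<omega>. L \<omega> \<partial>M)"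
    by (simp only: nn_integral_grid_avg[OF b(1) gm u])
  then show ?thesis unfolding L_def by (rule LIMSEQ_unique[OF tendsto_const])
qed

text \<open>
  Passing to the limit through truncations \<open>min g k\<close> avoids any uniform integrability argument
  when the weight \<open>g\<close> is unbounded (\<open>\<beta> = 0\<close>).
\<close>

lemma optional_stopping:
  assumes b: "continuous_on {0<..} b" "b \<in> borel_measurable borel"
    and g: "continuous_on UNIV g" "\<And>x. 0 \<le> g x" and u: "u > 0"
    and pos: "AE \<omega> in M. first_passage_time W b \<omega> \<noteq> 0"
  defines "\<tau> \<equiv> \<lambda>\<omega>. real_of_ereal (first_passage_time W b \<omega>)"
  shows "(\<integral>\<^sup>+ \<omega>. ennreal (g (W u \<omega>)) * indicator (hits b u) \<omega> \<partial>M)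
       = (\<integral>\<^sup>+ \<omega>. gauss_avg (sqrt (u - \<tau> \<omega>)) (\<lambda>y. ennreal (g y)) (b (\<tau> \<omega>)) * indicator (hits b u) \<omega> \<partial>M)"
proof -
  note [measurable] = first_passage_time_rv[OF b(1)] b(2)
  have gm [measurable]: "g \<in> borel_measurable borel" by (rule borel_measurable_continuous_onI[OF g(1)])
  have [measurable]: "hits b v \<in> sets M" for v by (rule hits_sets[OF b(1)])
  have [measurable]: "\<tau> \<in> borel_measurable M" unfolding \<tau>_def by measurable
  have [measurable]: "W u \<in> borel_measurable M" using u by (intro random_variable) simp
  define G where "G k y = min (g y) (real k)" for k y
  have [measurable]: "G k \<in> borel_measurable borel" for k unfolding G_def by measurable
  have inc: "incseq (\<lambda>k. ennreal (G k y))" for y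
    by (intro incseq_SucI ennreal_leI) (auto simp: G_def)
  have sup: "(SUP k. ennreal (G k y)) = ennreal (g y)" for y
  proof (rule LIMSEQ_unique[OF LIMSEQ_SUP[OF inc]])
    obtain k where "g y \<le> real k" using real_arch_simple by blast
    then have "\<forall>\<^sub>F n in sequentially. ennreal (g y) = ennreal (G n y)"
      unfolding eventually_sequentially G_def by (intro exI[of _ k]) (auto simp: min_def)
    then show "(\<lambda>k. ennreal (G k y)) \<longlonglongrightarrow> ennreal (g y)" by (rule Lim_transform_eventually[OF tendsto_const])
  qed
  have "(\<integral>\<^sup>+ \<omega>. ennreal (g (W u \<omega>)) * indicator (hits b u) \<omega> \<partial>M)
     = (\<integral>\<^sup>+ \<omega>. (SUP k. ennreal (G k (W u \<omega>)) * indicator (hits b u) \<omega>) \<partial>M)"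
    by (simp add: SUP_mult_right_ennreal[symmetric] sup)
  also have "\<dots> = (SUP k. \<integral>\<^sup>+ \<omega>. ennreal (G k (W u \<omega>)) * indicator (hits b u) \<omega> \<partial>M)"
    using inc by (intro nn_integral_monotone_convergence_SUP)
      (auto simp: incseq_def le_fun_def intro!: mult_right_mono)
  also have "\<dots> = (SUP k. \<integral>\<^sup>+ \<omega>. gauss_avg (sqrt (u - \<tau> \<omega>)) (\<lambda>y. ennreal (G k y)) (b (\<tau> \<omega>)) * indicator (hits b u) \<omega> \<partial>M)"
  proof (rule SUP_cong[OF refl])
    fix k
    show "(\<integral>\<^sup>+ \<omega>. ennreal (G k (W u \<omega>)) * indicator (hits b u) \<omega> \<partial>M)
      = (\<integral>\<^sup>+ \<omega>. gauss_avg (sqrt (u - \<tau> \<omega>)) (\<lambda>y. ennreal (G k y)) (b (\<tau> \<omega>)) * indicator (hits b u) \<omega> \<partial>M)"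
      unfolding \<tau>_def using g(2) unfolding G_def
      by (intro optional_stopping_bounded[OF b _ _ _ u pos, where K = "real k"] continuous_intros g(1)) auto
  qed
  also have "\<dots> = (\<integral>\<^sup>+ \<omega>. (SUP k. gauss_avg (sqrt (u - \<tau> \<omega>)) (\<lambda>y. ennreal (G k y)) (b (\<tau> \<omega>)) * indicator (hits b u) \<omega>) \<partial>M)"
  proof (rule nn_integral_monotone_convergence_SUP[symmetric])
    have "gauss_avg \<sigma> (\<lambda>y. ennreal (G m y)) x \<le> gauss_avg \<sigma> (\<lambda>y. ennreal (G n y)) x" if "m \<le> n" for m n \<sigma> x
      unfolding gauss_avg_def using inc that by (intro nn_integral_mono) (auto simp: incseq_def)
    then show "incseq (\<lambda>k \<omega>. gauss_avg (sqrt (u - \<tau> \<omega>)) (\<lambda>y. ennreal (G k y)) (b (\<tau> \<omega>)) * indicator (hits b u) \<omega>)"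
      unfolding incseq_def le_fun_def by (intro allI impI mult_right_mono) auto
  qed measurable
  also have "\<dots> = (\<integral>\<^sup>+ \<omega>. gauss_avg (sqrt (u - \<tau> \<omega>)) (\<lambda>y. ennreal (g y)) (b (\<tau> \<omega>)) * indicator (hits b u) \<omega> \<partial>M)"
  proof (intro nn_integral_cong)
    fix \<omega>
    have "(SUP k. gauss_avg (sqrt (u - \<tau> \<omega>)) (\<lambda>y. ennreal (G k y)) (b (\<tau> \<omega>)))
      = gauss_avg (sqrt (u - \<tau> \<omega>)) (\<lambda>y. SUP k. ennreal (G k y)) (b (\<tau> \<omega>))"
      unfolding gauss_avg_def using inc
      by (intro nn_integral_monotone_convergence_SUP[symmetric]) (auto simp: incseq_def le_fun_def)
    then show "(SUP k. gauss_avg (sqrt (u - \<tau> \<omega>)) (\<lambda>y. ennreal (G k y)) (b (\<tau> \<omega>)) * indicator (hits b u) \<omega>)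
      = gauss_avg (sqrt (u - \<tau> \<omega>)) (\<lambda>y. ennreal (g y)) (b (\<tau> \<omega>)) * indicator (hits b u) \<omega>"
      by (simp add: SUP_mult_right_ennreal[symmetric] sup)
  qed
  finally show ?thesis .
qed

end

section \<open>The transformed process as an h-transform\<close>

text \<open>
  For \<open>\<beta> > 0\<close> this is \<open>p (1/\<beta> - s, x, -\<eta>/\<beta>) / p (1/\<beta>, 0, -\<eta>/\<beta>)\<close> with \<open>p\<close> the heat kernel, that is, the
  \<open>h\<close>-transform conditioning \<open>W\<close> to be at \<open>-\<eta>/\<beta>\<close> at time \<open>1/\<beta>\<close>; for \<open>\<beta> = 0\<close> it is the Girsanov
  density of the drift \<open>-\<eta>\<close>.
\<close>

definition bridge_weight :: "real \<Rightarrow> real \<Rightarrow> real \<Rightarrow> real \<Rightarrow> real" where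
  "bridge_weight \<beta> \<eta> s x = exp (- (\<beta> * x\<^sup>2 / 2 + \<eta> * x + \<eta>\<^sup>2 * s / 2) / (1 - \<beta> * s)) / sqrt (1 - \<beta> * s)"

lemma continuous_bridge_weight: "continuous_on UNIV (bridge_weight \<beta> \<eta> s)"
proof -
  \<comment> \<open>With \<open>s\<close> fixed the denominators are constants; writing them with
    \<open>inverse\<close> spares a nonvanishing condition on
    \<open>1 - \<beta> * s\<close>.\<close>
  have "continuous_on UNIV (\<lambda>x. exp (- (\<beta> * x\<^sup>2 / 2 + \<eta> * x + \<eta>\<^sup>2 * s / 2) * inverse (1 - \<beta> * s)) * inverse (sqrt (1 - \<beta> * s)))"
    by (intro continuous_intros) auto
  also have "(\<lambda>x. exp (- (\<beta> * x\<^sup>2 / 2 + \<eta> * x + \<eta>\<^sup>2 * s / 2) * inverse (1 - \<beta> * s)) * inverse (sqrt (1 - \<beta> * s)))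
      = bridge_weight \<beta> \<eta> s"
    by (rule ext) (simp only: bridge_weight_def divide_inverse)
  finally show ?thesis .
qed

lemma measurable_bridge_weight [measurable]: "bridge_weight \<beta> \<eta> s \<in> borel_measurable borel"
  by (rule borel_measurable_continuous_onI[OF continuous_bridge_weight])

lemma bridge_weight_nonneg: "\<beta> * s < 1 \<Longrightarrow> 0 \<le> bridge_weight \<beta> \<eta> s x"
  by (simp add: bridge_weight_def)

text \<open>The exponents of the kernel identity below. The mean and variance on the left belong to
  the transformed process at \<open>s'\<close> given position \<open>x\<close> at \<open>s\<close>.
  Over the common denominator \<open>2 * c * c' * d\<close> the claim becomes a polynomial
  identity.\<close>

lemma bridge_exponent:
  fixes x y :: real
  assumes c: "1 - \<beta> * s > 0" "1 - \<beta> * s' > 0" and "s < s'"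
  defines "c \<equiv> 1 - \<beta> * s" and "c' \<equiv> 1 - \<beta> * s'"
  shows "(\<beta> * x\<^sup>2 / 2 + \<eta> * x + \<eta>\<^sup>2 * s / 2) / c + (y - (c' * x - \<eta> * (s' - s)) / c)\<^sup>2 / (2 * (c' / c * (s' - s)))
    = (y - x)\<^sup>2 / (2 * (s' - s)) + (\<beta> * y\<^sup>2 / 2 + \<eta> * y + \<eta>\<^sup>2 * s' / 2) / c'"
proof -
  define d where "d = s' - s"
  have pos: "c > 0" "c' > 0" "d > 0" using assms by (auto simp: d_def)
  have "(\<beta> * x\<^sup>2 / 2 + \<eta> * x + \<eta>\<^sup>2 * s / 2) / c = c' * d * (\<beta> * x\<^sup>2 + 2 * \<eta> * x + \<eta>\<^sup>2 * s) / (2 * c * c' * d)"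
    using pos by (simp add: field_simps)
  moreover have "(y - (c' * x - \<eta> * d) / c)\<^sup>2 / (2 * (c' / c * d)) = (c * y - c' * x + \<eta> * d)\<^sup>2 / (2 * c * c' * d)"
  proof -
    have "y - (c' * x - \<eta> * d) / c = (c * y - c' * x + \<eta> * d) / c"
      using pos by (simp add: field_simps)
    then have "(y - (c' * x - \<eta> * d) / c)\<^sup>2 = (c * y - c' * x + \<eta> * d)\<^sup>2 / c\<^sup>2"
      by (simp only: power_divide)
    then show ?thesis using pos by (simp add: power2_eq_square)
  qed
  moreover have "(y - x)\<^sup>2 / (2 * d) = c * c' * (y - x)\<^sup>2 / (2 * c * c' * d)"
    using pos by simp
  moreover have "(\<beta> * y\<^sup>2 / 2 + \<eta> * y + \<eta>\<^sup>2 * s' / 2) / c' = c * d * (\<beta> * y\<^sup>2 + 2 * \<eta> * y + \<eta>\<^sup>2 * s') / (2 * c * c' * d)"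
    using pos by (simp add: field_simps)
  moreover have "c' * d * (\<beta> * x\<^sup>2 + 2 * \<eta> * x + \<eta>\<^sup>2 * s) + (c * y - c' * x + \<eta> * d)\<^sup>2
     = c * c' * (y - x)\<^sup>2 + c * d * (\<beta> * y\<^sup>2 + 2 * \<eta> * y + \<eta>\<^sup>2 * s')"
    unfolding c_def c'_def d_def by (simp add: power2_eq_square algebra_simps)
  ultimately show ?thesis unfolding d_def[symmetric] by (simp only: add_divide_distrib[symmetric])
qed

text \<open>Doob's h-transform at the level of densities: the transition density of the transformed
  process is the heat kernel times the quotient of the weights at the two ends. The normalising
  constants agree because the factor \<open>c' / c\<close> in the variance converts
  \<open>sqrt c\<close> into \<open>sqrt c'\<close>.\<close>

lemma bridge_weight_kernel:
  assumes c: "1 - \<beta> * s > 0" "1 - \<beta> * s' > 0" and "s < s'"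
  defines "c \<equiv> 1 - \<beta> * s" and "c' \<equiv> 1 - \<beta> * s'"
  shows "bridge_weight \<beta> \<eta> s x * normal_density ((c' * x - \<eta> * (s' - s)) / c) (sqrt (c' / c * (s' - s))) y
    = normal_density x (sqrt (s' - s)) y * bridge_weight \<beta> \<eta> s' y"
proof -
  define d where "d = s' - s"
  have pos: "c > 0" "c' > 0" "d > 0" using assms by (auto simp: d_def)
  define m where "m = (c' * x - \<eta> * d) / c"
  define A where "A = (\<beta> * x\<^sup>2 / 2 + \<eta> * x + \<eta>\<^sup>2 * s / 2) / c"
  define B where "B = (\<beta> * y\<^sup>2 / 2 + \<eta> * y + \<eta>\<^sup>2 * s' / 2) / c'"
  have E: "A + (y - m)\<^sup>2 / (2 * (c' / c * d)) = (y - x)\<^sup>2 / (2 * d) + B"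
    using bridge_exponent[OF c \<open>s < s'\<close>, of x \<eta> y] by (simp only: A_def B_def c_def c'_def d_def m_def)
  have ex: "exp (- (p + q)) = exp (- p) * exp (- q)" for p q :: real
    by (simp add: exp_add[symmetric])
  have nd: "normal_density \<mu> (sqrt v) z = 1 / sqrt (2 * pi * v) * exp (- ((z - \<mu>)\<^sup>2 / (2 * v)))"
    if "0 < v" for \<mu> v z :: real
    using that by (simp add: normal_density_def)
  have v: "0 < c' / c * d" using pos by simp
  have bw: "bridge_weight \<beta> \<eta> s x = exp (- A) / sqrt c"
    unfolding bridge_weight_def A_def c_def by (simp only: minus_divide_left)
  have bw': "bridge_weight \<beta> \<eta> s' y = exp (- B) / sqrt c'"
    unfolding bridge_weight_def B_def c'_def by (simp only: minus_divide_left)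
  have "bridge_weight \<beta> \<eta> s x * normal_density m (sqrt (c' / c * d)) y
     = exp (- A) / sqrt c * (1 / sqrt (2 * pi * (c' / c * d)) * exp (- ((y - m)\<^sup>2 / (2 * (c' / c * d)))))"
    unfolding nd[OF v] bw ..
  also have "\<dots> = exp (- (A + (y - m)\<^sup>2 / (2 * (c' / c * d)))) * (1 / sqrt c * (1 / sqrt (2 * pi * (c' / c * d))))"
    unfolding ex by simp
  also have "1 / sqrt c * (1 / sqrt (2 * pi * (c' / c * d))) = 1 / sqrt (2 * pi * d) * (1 / sqrt c')"
    using pos by (simp add: real_sqrt_mult real_sqrt_divide)
  also have "exp (- (A + (y - m)\<^sup>2 / (2 * (c' / c * d)))) * (1 / sqrt (2 * pi * d) * (1 / sqrt c'))
     = (1 / sqrt (2 * pi * d) * exp (- ((y - x)\<^sup>2 / (2 * d)))) * (exp (- B) / sqrt c')"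
    unfolding E ex by simp
  also have "\<dots> = normal_density x (sqrt d) y * bridge_weight \<beta> \<eta> s' y"
    unfolding nd[OF pos(3)] bw' ..
  finally show ?thesis unfolding m_def d_def .
qed

text \<open>The kernel identity integrated against a test function, extended to
  \<open>s = s'\<close>, where there is no transition density. General \<open>F\<close> transfers
  one transition step between the two processes; constant \<open>F = 1\<close> says that the weight
  is space-time harmonic, hence gives a martingale along \<open>W\<close>.\<close>

lemma gauss_avg_bridge_weight:
  assumes c: "1 - \<beta> * s > 0" "1 - \<beta> * s' > 0" and "s \<le> s'" and [measurable]: "F \<in> borel_measurable borel"
  defines "c \<equiv> 1 - \<beta> * s" and "c' \<equiv> 1 - \<beta> * s'"
  shows "ennreal (bridge_weight \<beta> \<eta> s x) * gauss_avg (sqrt (c' / c * (s' - s))) F ((c' * x - \<eta> * (s' - s)) / c)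
    = gauss_avg (sqrt (s' - s)) (\<lambda>y. ennreal (bridge_weight \<beta> \<eta> s' y) * F y) x"
proof (cases "s = s'")
  case True
  then show ?thesis using c by (simp add: c_def c'_def)
next
  case False
  then have "s < s'" using \<open>s \<le> s'\<close> by simp
  have pos: "c > 0" "c' > 0" using assms by auto
  then have "c' / c * (s' - s) > 0" using \<open>s < s'\<close> by simp
  then have \<sigma>: "sqrt (c' / c * (s' - s)) > 0" by simp
  have w: "0 \<le> bridge_weight \<beta> \<eta> s x" "0 \<le> bridge_weight \<beta> \<eta> s' y" for y
    using c by (auto intro: bridge_weight_nonneg)
  have \<sigma>': "sqrt (s' - s) > 0" using \<open>s < s'\<close> by simp
  define m where "m = (c' * x - \<eta> * (s' - s)) / c"
  have kernel: "ennreal (bridge_weight \<beta> \<eta> s x) * (F y * ennreal (normal_density m (sqrt (c' / c * (s' - s))) y))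
      = ennreal (bridge_weight \<beta> \<eta> s' y) * F y * ennreal (normal_density x (sqrt (s' - s)) y)" for y
  proof -
    have "ennreal (bridge_weight \<beta> \<eta> s x) * ennreal (normal_density m (sqrt (c' / c * (s' - s))) y)
        = ennreal (bridge_weight \<beta> \<eta> s' y) * ennreal (normal_density x (sqrt (s' - s)) y)"
      using bridge_weight_kernel[OF c \<open>s < s'\<close>, of \<eta> x y] w
      by (simp add: ennreal_mult[symmetric] c_def c'_def m_def mult.commute)
    then show ?thesis by (simp only: ac_simps)
  qed
  have "ennreal (bridge_weight \<beta> \<eta> s x) * gauss_avg (sqrt (c' / c * (s' - s))) F m
      = (\<integral>\<^sup>+ y. ennreal (bridge_weight \<beta> \<eta> s x) * (F y * ennreal (normal_density m (sqrt (c' / c * (s' - s))) y)) \<partial>lborel)"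
    unfolding gauss_avg_eq_normal_density[OF \<open>F \<in> borel_measurable borel\<close> \<sigma>]
    by (rule nn_integral_cmult[symmetric]) measurable
  also have "\<dots> = gauss_avg (sqrt (s' - s)) (\<lambda>y. ennreal (bridge_weight \<beta> \<eta> s' y) * F y) x"
    unfolding kernel by (rule gauss_avg_eq_normal_density[symmetric, OF _ \<sigma>']) measurable
  finally show ?thesis unfolding m_def .
qed

lemma scale_pos:
  fixes \<beta> s u :: real
  assumes "0 \<le> \<beta>" "s \<le> u" "\<beta> * u < 1"
  shows "1 - \<beta> * s > 0"
  using mult_left_mono[OF assms(2,1)] assms(3) by simp

text \<open>The inverse of the time change \<open>t \<mapsto> \<gamma> t / (1 + \<beta> \<gamma> t)\<close> of the theorem.\<close>

definition clock :: "real \<Rightarrow> real \<Rightarrow> real \<Rightarrow> real" where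
  "clock \<beta> \<gamma> s = s / (\<gamma> * (1 - \<beta> * s))"

text \<open>This is the variance of the increment of \<open>W\<close> between two clock times; the
  terms \<beta> s s' cancel on cross-multiplication.\<close>

lemma clock_diff:
  assumes "1 - \<beta> * s > 0" "1 - \<beta> * s' > 0" "\<gamma> > 0"
  shows "clock \<beta> \<gamma> s' - clock \<beta> \<gamma> s = (s' - s) / (\<gamma> * (1 - \<beta> * s) * (1 - \<beta> * s'))"
proof -
  define c c' where "c = 1 - \<beta> * s" and "c' = 1 - \<beta> * s'"
  have pos: "c > 0" "c' > 0" using assms by (auto simp: c_def c'_def)
  have "s' / (\<gamma> * c') - s / (\<gamma> * c) = (s' * c - s * c') / (\<gamma> * c * c')"
    using pos assms(3) by (simp add: field_simps)
  moreover have "s' * c - s * c' = s' - s" by (simp add: c_def c'_def algebra_simps)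
  ultimately show ?thesis by (simp add: clock_def c_def c'_def)
qed

lemma clock_nonneg: "0 \<le> \<beta> \<Longrightarrow> \<gamma> > 0 \<Longrightarrow> 0 \<le> s \<Longrightarrow> \<beta> * s < 1 \<Longrightarrow> 0 \<le> clock \<beta> \<gamma> s"
  by (simp add: clock_def)

lemma clock_mono:
  assumes "0 \<le> \<beta>" "\<gamma> > 0" "s \<le> s'" "\<beta> * s' < 1"
  shows "clock \<beta> \<gamma> s \<le> clock \<beta> \<gamma> s'"
proof -
  have c: "1 - \<beta> * s > 0" "1 - \<beta> * s' > 0" using scale_pos[of \<beta> s s'] assms by auto
  have "0 \<le> clock \<beta> \<gamma> s' - clock \<beta> \<gamma> s"
    unfolding clock_diff[OF c assms(2)] using c assms by simp
  then show ?thesis by simp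
qed

section \<open>The law of the transformed process before time 1/\<beta>\<close>

context standard_brownian_motion begin

text \<open>The factor \<open>sqrt \<gamma>\<close> and the division by \<gamma> in
  \<open>clock\<close> are Brownian scaling. The map taking \<open>W\<close> to (1 - \<beta> s) W (s
  / (1 - \<beta> s)) is the classical construction of a Brownian bridge of length 1/\<beta>, and the
  drift \<alpha> turns into the linear term - (\<alpha> / sqrt \<gamma>) s.\<close>

definition bridge :: "real \<Rightarrow> real \<Rightarrow> real \<Rightarrow> real \<Rightarrow> 'a \<Rightarrow> real" where
  "bridge \<alpha> \<beta> \<gamma> s \<omega> = sqrt \<gamma> * (1 - \<beta> * s) * (W (clock \<beta> \<gamma> s) \<omega> - \<alpha> * clock \<beta> \<gamma> s)"

lemma bridge_measurable_past:
  assumes "0 \<le> \<beta>" "\<gamma> > 0" "0 \<le> j" "j \<le> s" "\<beta> * s < 1"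
  shows "bridge \<alpha> \<beta> \<gamma> j \<in> borel_measurable (past (clock \<beta> \<gamma> s))"
proof -
  have "\<beta> * j < 1" using scale_pos[OF assms(1,4,5)] by simp
  then have [measurable]: "W (clock \<beta> \<gamma> j) \<in> borel_measurable (past (clock \<beta> \<gamma> s))"
    using assms by (intro W_measurable_past clock_nonneg clock_mono) auto
  show ?thesis unfolding bridge_def by measurable
qed

lemma bridge_measurable:
  assumes "0 \<le> \<beta>" "\<gamma> > 0" "0 \<le> s" "\<beta> * s < 1"
  shows "bridge \<alpha> \<beta> \<gamma> s \<in> borel_measurable M"
  using bridge_measurable_past[OF assms(1-3) order_refl assms(4)] measurable_from_subalg[OF subalgebra_past] by blast

text \<open>At a fixed time the process is an affine image \<open>a * W t' + m\<close> of the
  Brownian motion with deterministic coefficients, so the Markov property carries over;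
  \<open>clock_diff\<close> supplies the new mean and variance.\<close>

lemma bridge_markov:
  fixes \<alpha> :: real
  assumes par: "0 \<le> \<beta>" "\<gamma> > 0" and s: "0 \<le> s" "s \<le> s'" "\<beta> * s' < 1"
    and A: "A \<in> sets (past (clock \<beta> \<gamma> s))" and [measurable]: "F \<in> borel_measurable borel"
  defines "c \<equiv> 1 - \<beta> * s" and "c' \<equiv> 1 - \<beta> * s'" and "\<eta> \<equiv> \<alpha> / sqrt \<gamma>"
  shows "(\<integral>\<^sup>+ \<omega>. F (bridge \<alpha> \<beta> \<gamma> s' \<omega>) * indicator A \<omega> \<partial>M)
    = (\<integral>\<^sup>+ \<omega>. gauss_avg (sqrt (c' / c * (s' - s))) F ((c' * bridge \<alpha> \<beta> \<gamma> s \<omega> - \<eta> * (s' - s)) / c) * indicator A \<omega> \<partial>M)"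
proof -
  have c: "1 - \<beta> * s > 0" by (rule scale_pos[OF par(1) s(2,3)])
  have c': "1 - \<beta> * s' > 0" using s(3) by simp
  have pos: "c > 0" "c' > 0" unfolding c_def c'_def by fact+
  define t t' where "t = clock \<beta> \<gamma> s" and "t' = clock \<beta> \<gamma> s'"
  have t: "0 \<le> t" "t \<le> t'"
    using clock_nonneg[OF par s(1)] clock_mono[OF par s(2,3)] c by (simp_all add: t_def t'_def)
  have td: "t' - t = (s' - s) / (\<gamma> * c * c')"
    unfolding t_def t'_def c_def c'_def by (rule clock_diff[OF c c' par(2)])
  define a m where "a = sqrt \<gamma> * c'" and "m = - (a * \<alpha> * t')"
  have X': "bridge \<alpha> \<beta> \<gamma> s' \<omega> = a * W t' \<omega> + m" for \<omega>
    by (simp add: bridge_def a_def m_def t'_def c'_def algebra_simps)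
  have \<gamma>: "\<gamma> = sqrt \<gamma> * sqrt \<gamma>" "sqrt \<gamma> > 0" using par by simp_all
  have a0: "0 \<le> a" using pos \<gamma>(2) by (simp add: a_def)
  have \<sigma>: "a * sqrt (t' - t) = sqrt (c' / c * (s' - s))"
  proof -
    have "a * a = (sqrt \<gamma> * sqrt \<gamma>) * (c' * c')" by (simp only: a_def ac_simps)
    then have aa: "a * a = \<gamma> * (c' * c')" using \<gamma>(1) by simp
    have "a * a * (t' - t) = (\<gamma> * c') * (c' * (s' - s)) / ((\<gamma> * c') * c)"
      unfolding td aa by (simp only: ac_simps times_divide_eq_right)
    also have "\<dots> = c' / c * (s' - s)" using pos par by simp
    finally have "a * a * (t' - t) = c' / c * (s' - s)" .
    then have "sqrt (c' / c * (s' - s)) = sqrt (a * a) * sqrt (t' - t)"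
      using real_sqrt_mult[of "a * a" "t' - t"] by simp
    also have "sqrt (a * a) = a" using a0 by simp
    finally show ?thesis ..
  qed
  have mean: "a * W t \<omega> + m = (c' * bridge \<alpha> \<beta> \<gamma> s \<omega> - \<eta> * (s' - s)) / c" for \<omega>
  proof -
    have "a * \<alpha> * (t' - t) = sqrt \<gamma> * c' * \<alpha> * (s' - s) / (\<gamma> * c * c')"
      unfolding td a_def by simp
    also have "\<dots> = \<alpha> * (s' - s) * (sqrt \<gamma> * c') / (sqrt \<gamma> * c * (sqrt \<gamma> * c'))"
      by (subst (2) \<gamma>(1)) (simp only: ac_simps)
    also have "\<dots> = \<eta> * (s' - s) / c"
      using pos \<gamma>(2) by (simp add: \<eta>_def)
    finally have 1: "a * \<alpha> * (t' - t) = \<eta> * (s' - s) / c" .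
    have "a * W t \<omega> + m = a * (W t \<omega> - \<alpha> * t) - a * \<alpha> * (t' - t)"
      by (simp add: m_def algebra_simps)
    also have "a * (W t \<omega> - \<alpha> * t) = c' * bridge \<alpha> \<beta> \<gamma> s \<omega> / c"
      using pos by (simp add: a_def bridge_def t_def c_def)
    finally show ?thesis unfolding 1 by (simp add: diff_divide_distrib)
  qed
  have "(\<integral>\<^sup>+ \<omega>. F (bridge \<alpha> \<beta> \<gamma> s' \<omega>) * indicator A \<omega> \<partial>M)
     = (\<integral>\<^sup>+ \<omega>. gauss_avg (sqrt (t' - t)) (\<lambda>w. F (a * w + m)) (W t \<omega>) * indicator A \<omega> \<partial>M)"
    unfolding X' using t A unfolding t_def by (intro markov[where F = "\<lambda>w. F (a * w + m)"]) auto
  then show ?thesis unfolding gauss_avg_affine \<sigma> mean .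
qed

text \<open>Induction on the largest time in \<open>J\<close>. The general test function
  \<open>G\<close> and terminal time \<open>u\<close> are what make the induction close: the
  transition after the last time \<open>s\<close> becomes part of a new test function at
  \<open>s\<close>, and the weight is then carried from \<open>s\<close> to \<open>u\<close> by
  \<open>gauss_avg_bridge_weight\<close>.\<close>

lemma bridge_finite_dim_law:
  fixes \<alpha> :: real
  assumes par: "0 \<le> \<beta>" "\<gamma> > 0"
    and "finite J" "J \<subseteq> {0..u}" "0 \<le> u" "\<beta> * u < 1" and A: "\<And>j. A j \<in> sets borel"
    and "G \<in> borel_measurable borel"
  defines "\<eta> \<equiv> \<alpha> / sqrt \<gamma>"
  shows "(\<integral>\<^sup>+ \<omega>. G (bridge \<alpha> \<beta> \<gamma> u \<omega>) * indicator {\<omega> \<in> space M. \<forall>j\<in>J. bridge \<alpha> \<beta> \<gamma> j \<omega> \<in> A j} \<omega> \<partial>M)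
    = (\<integral>\<^sup>+ \<omega>. ennreal (bridge_weight \<beta> \<eta> u (W u \<omega>)) * G (W u \<omega>) * indicator {\<omega> \<in> space M. \<forall>j\<in>J. W j \<omega> \<in> A j} \<omega> \<partial>M)"
  using assms(3,4,5,6,8)
proof (induction J arbitrary: u G rule: finite_linorder_max_induct)
  case empty
  note [measurable] = \<open>G \<in> borel_measurable borel\<close>
  have X0: "bridge \<alpha> \<beta> \<gamma> 0 \<omega> = sqrt \<gamma> * W 0 \<omega>" for \<omega> by (simp add: bridge_def clock_def)
  have c: "1 - \<beta> * 0 > 0" "1 - \<beta> * u > 0" using empty by auto
  have "(\<integral>\<^sup>+ \<omega>. G (bridge \<alpha> \<beta> \<gamma> u \<omega>) * indicator (space M) \<omega> \<partial>M)
    = (\<integral>\<^sup>+ \<omega>. gauss_avg (sqrt ((1 - \<beta> * u) / (1 - \<beta> * 0) * (u - 0))) G (((1 - \<beta> * u) * bridge \<alpha> \<beta> \<gamma> 0 \<omega> - \<eta> * (u - 0)) / (1 - \<beta> * 0)) * indicator (space M) \<omega> \<partial>M)"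
    unfolding \<eta>_def using empty sets.top[of "past (clock \<beta> \<gamma> 0)"] by (intro bridge_markov par) auto
  also have "\<dots> = (\<integral>\<^sup>+ \<omega>. gauss_avg (sqrt (u - 0)) (\<lambda>y. ennreal (bridge_weight \<beta> \<eta> u y) * G y) (W 0 \<omega>) * indicator (space M) \<omega> \<partial>M)"
  proof (rule nn_integral_cong_AE)
    \<comment> \<open>Both processes start at 0 almost surely, and the weight is normalised to 1
      there.\<close>
    have w0: "bridge_weight \<beta> \<eta> 0 0 = 1" by (simp add: bridge_weight_def)
    show "AE \<omega> in M. gauss_avg (sqrt ((1 - \<beta> * u) / (1 - \<beta> * 0) * (u - 0))) G (((1 - \<beta> * u) * bridge \<alpha> \<beta> \<gamma> 0 \<omega> - \<eta> * (u - 0)) / (1 - \<beta> * 0)) * indicator (space M) \<omega>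
      = gauss_avg (sqrt (u - 0)) (\<lambda>y. ennreal (bridge_weight \<beta> \<eta> u y) * G y) (W 0 \<omega>) * indicator (space M) \<omega>"
      using start_0
    proof eventually_elim
      case (elim \<omega>)
      then show ?case
        using gauss_avg_bridge_weight[OF c \<open>0 \<le> u\<close> \<open>G \<in> borel_measurable borel\<close>, of \<eta> 0] w0
        by (simp add: X0)
    qed
  qed
  also have "\<dots> = (\<integral>\<^sup>+ \<omega>. ennreal (bridge_weight \<beta> \<eta> u (W u \<omega>)) * G (W u \<omega>) * indicator (space M) \<omega> \<partial>M)"
    using empty sets.top[of "past 0"]
    by (intro markov[symmetric, where F = "\<lambda>y. ennreal (bridge_weight \<beta> \<eta> u y) * G y"]) auto
  finally show ?case by simp
next
  case (insert s J)
  note [measurable] = \<open>G \<in> borel_measurable borel\<close> A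
  have s: "0 \<le> s" "s \<le> u" and J: "J \<subseteq> {0..s}" and Ju: "J \<subseteq> {0..u}"
    using insert by (auto simp: less_imp_le)
  have \<beta>s: "\<beta> * s < 1" using scale_pos[OF par(1) s(2)] insert by simp
  have c: "1 - \<beta> * s > 0" "1 - \<beta> * u > 0" using insert \<beta>s by auto
  define X where "X = bridge \<alpha> \<beta> \<gamma>"
  define C where "C K = {\<omega> \<in> space M. \<forall>j\<in>K. X j \<omega> \<in> A j}" for K
  define D where "D K = {\<omega> \<in> space M. \<forall>j\<in>K. W j \<omega> \<in> A j}" for K
  \<comment> \<open>\<open>Q\<close> absorbs both the transition from \<open>s\<close> to
    \<open>u\<close> and the constraint at time \<open>s\<close>, leaving a cylinder over the
    earlier times \<open>J\<close> with terminal time \<open>s\<close>.\<close>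
  define Q where "Q x = gauss_avg (sqrt ((1 - \<beta> * u) / (1 - \<beta> * s) * (u - s))) G (((1 - \<beta> * u) * x - \<eta> * (u - s)) / (1 - \<beta> * s)) * indicator (A s) x" for x
  have Qm: "Q \<in> borel_measurable borel" unfolding Q_def by measurable
  have Cp: "C (insert s J) \<in> sets (past (clock \<beta> \<gamma> s))"
    unfolding C_def X_def space_past[of "clock \<beta> \<gamma> s", symmetric]
    using insert J s \<beta>s by (intro cylinder_in_sets A bridge_measurable_past par) auto
  have Dp: "D (insert s J) \<in> sets (past s)"
    unfolding D_def space_past[of s, symmetric]
    using insert J s by (intro cylinder_in_sets A W_measurable_past) auto
  have "(\<integral>\<^sup>+ \<omega>. G (X u \<omega>) * indicator (C (insert s J)) \<omega> \<partial>M)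
    = (\<integral>\<^sup>+ \<omega>. gauss_avg (sqrt ((1 - \<beta> * u) / (1 - \<beta> * s) * (u - s))) G (((1 - \<beta> * u) * X s \<omega> - \<eta> * (u - s)) / (1 - \<beta> * s)) * indicator (C (insert s J)) \<omega> \<partial>M)"
    unfolding \<eta>_def X_def using insert s Cp by (intro bridge_markov par) auto
  also have "\<dots> = (\<integral>\<^sup>+ \<omega>. Q (X s \<omega>) * indicator (C J) \<omega> \<partial>M)"
    by (intro nn_integral_cong) (auto simp: Q_def C_def split: split_indicator)
  also have "\<dots> = (\<integral>\<^sup>+ \<omega>. ennreal (bridge_weight \<beta> \<eta> s (W s \<omega>)) * Q (W s \<omega>) * indicator (D J) \<omega> \<partial>M)"
    unfolding C_def D_def X_def by (rule insert.IH[OF J s(1) \<beta>s Qm])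
  also have "\<dots> = (\<integral>\<^sup>+ \<omega>. gauss_avg (sqrt (u - s)) (\<lambda>y. ennreal (bridge_weight \<beta> \<eta> u y) * G y) (W s \<omega>) * indicator (D (insert s J)) \<omega> \<partial>M)"
    by (intro nn_integral_cong)
       (auto simp: Q_def D_def gauss_avg_bridge_weight[OF c s(2) \<open>G \<in> borel_measurable borel\<close>, symmetric] split: split_indicator)
  also have "\<dots> = (\<integral>\<^sup>+ \<omega>. ennreal (bridge_weight \<beta> \<eta> u (W u \<omega>)) * G (W u \<omega>) * indicator (D (insert s J)) \<omega> \<partial>M)"
    using s Dp by (intro markov[symmetric, where F = "\<lambda>y. ennreal (bridge_weight \<beta> \<eta> u y) * G y"]) auto
  finally show ?case unfolding C_def D_def X_def .
qed


lemma continuous_bridge: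
  assumes par: "0 \<le> \<beta>" "\<gamma> > 0" "\<beta> * u < 1" and \<omega>: "\<omega> \<in> space M"
  shows "continuous_on {0<..u} (\<lambda>s. bridge \<alpha> \<beta> \<gamma> s \<omega>)"
proof -
  have c: "1 - \<beta> * s > 0" if "s \<in> {0<..u}" for s
    using that by (intro scale_pos[OF par(1) _ par(3)]) simp
  have cl: "continuous_on {0<..u} (clock \<beta> \<gamma>)"
    unfolding clock_def using c par(2) by (intro continuous_intros) (auto simp: less_imp_neq[symmetric] dest!: c)
  have im: "clock \<beta> \<gamma> ` {0<..u} \<subseteq> {0..}"
    using c par by (auto intro!: clock_nonneg)
  have "continuous_on {0<..u} (\<lambda>s. W (clock \<beta> \<gamma> s) \<omega>)"
    by (rule continuous_on_compose2[OF continuous_paths[OF \<omega>] cl im])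
  then show ?thesis unfolding bridge_def by (intro continuous_intros cl)
qed

text \<open>Contact is decided by the values at rational times, so it is an event in a countable
  product space. There the law of the transformed process and the weighted law of \<open>W\<close>
  coincide because they agree on cylinders.\<close>

lemma emeasure_bridge_hits:
  fixes \<alpha> :: real
  assumes par: "0 \<le> \<beta>" "\<gamma> > 0" and u: "u > 0" "\<beta> * u < 1" and b: "continuous_on {0<..} b"
  shows "emeasure M {\<omega> \<in> space M. \<exists>s\<in>{0<..u}. bridge \<alpha> \<beta> \<gamma> s \<omega> \<le> b s}
    = (\<integral>\<^sup>+ \<omega>. ennreal (bridge_weight \<beta> (\<alpha> / sqrt \<gamma>) u (W u \<omega>)) * indicator (hits b u) \<omega> \<partial>M)"
proof -
  define h where "h = (\<lambda>\<omega>. ennreal (bridge_weight \<beta> (\<alpha> / sqrt \<gamma>) u (W u \<omega>)))"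
  have Wu: "W u \<in> borel_measurable M" using u by (intro random_variable) simp
  have hm [measurable]: "h \<in> borel_measurable M"
    unfolding h_def by (intro measurable_compose[OF Wu]) measurable
  define D where "D = \<rat> \<inter> {0<..<u}"
  define X where "X = (\<lambda>\<omega>. \<lambda>q\<in>D. bridge \<alpha> \<beta> \<gamma> q \<omega>)"
  define Y where "Y = (\<lambda>\<omega>. \<lambda>q\<in>D. W q \<omega>)"
  define P where "P = (PiM D (\<lambda>_. borel) :: (real \<Rightarrow> real) measure)"
  have c: "\<beta> * q < 1" if "q \<le> u" for q using scale_pos[OF par(1) that u(2)] by simp
  have Xm [measurable]: "X \<in> measurable M P"
    unfolding X_def P_def using c by (intro measurable_restrict bridge_measurable par) (auto simp: D_def)
  have Ym [measurable]: "Y \<in> measurable M P"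
    unfolding Y_def P_def by (intro measurable_restrict random_variable) (auto simp: D_def)
  have bcont: "continuous_on {0<..u} b" by (rule continuous_on_subset[OF b]) auto
  have eq: "distr M P X = distr (density M h) P Y"
    unfolding P_def
  proof (rule measure_eqI_PiM_infinite)
    fix A :: "real \<Rightarrow> real set" and J
    assume J: "finite J" "J \<subseteq> D" and A: "\<And>i. i \<in> J \<Longrightarrow> A i \<in> sets borel"
    \<comment> \<open>Indices outside \<open>J\<close> receive \<open>UNIV\<close>, since the
      finite-dimensional statement asks for a Borel set at every index.\<close>
    define A' where "A' j = (if j \<in> J then A j else UNIV)" for j
    have A': "A' j \<in> sets borel" for j using A by (simp add: A'_def)
    have Ju: "J \<subseteq> {0..u}" using J(2) by (auto simp: D_def)
    define C where "C = {\<omega> \<in> space M. \<forall>j\<in>J. bridge \<alpha> \<beta> \<gamma> j \<omega> \<in> A' j}"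
    define E where "E = {\<omega> \<in> space M. \<forall>j\<in>J. W j \<omega> \<in> A' j}"
    define S where "S = prod_emb D (\<lambda>_. borel :: real measure) J (Pi\<^sub>E J A)"
    have S: "S \<in> sets P" unfolding S_def P_def using J A by (intro sets_PiM_I) auto
    have XS: "X -` S \<inter> space M = C"
      using J(2) by (auto simp: S_def C_def X_def prod_emb_def A'_def space_PiM Pi_iff restrict_def subset_iff extensional_def PiE_iff)
    have YS: "Y -` S \<inter> space M = E"
      using J(2) by (auto simp: S_def E_def Y_def prod_emb_def A'_def space_PiM Pi_iff restrict_def subset_iff extensional_def PiE_iff)
    have Cm: "C \<in> sets M" using measurable_sets[OF Xm S] XS by simp
    have Em: "E \<in> sets M" using measurable_sets[OF Ym S] YS by simp
    have "emeasure (distr M P X) S = emeasure M C"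
      using XS by (simp add: emeasure_distr[OF Xm S])
    also have "\<dots> = (\<integral>\<^sup>+ \<omega>. (\<lambda>_. 1) (bridge \<alpha> \<beta> \<gamma> u \<omega>) * indicator C \<omega> \<partial>M)"
      using Cm by simp
    also have "\<dots> = (\<integral>\<^sup>+ \<omega>. h \<omega> * (\<lambda>_. 1) (W u \<omega>) * indicator E \<omega> \<partial>M)"
      unfolding C_def E_def h_def using u J(1) Ju by (intro bridge_finite_dim_law par A') auto
    also have "\<dots> = emeasure (density M h) E"
      using Em by (simp add: emeasure_density)
    also have "\<dots> = emeasure (distr (density M h) P Y) S"
      using YS Ym S by (subst emeasure_distr) auto
    finally show "emeasure (distr M (PiM D (\<lambda>_. borel)) X) (prod_emb D (\<lambda>_. borel) J (Pi\<^sub>E J A))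
       = emeasure (distr (density M h) (PiM D (\<lambda>_. borel)) Y) (prod_emb D (\<lambda>_. borel) J (Pi\<^sub>E J A))"
      unfolding S_def P_def .
  next
    show "finite_measure (distr M (PiM D (\<lambda>_. borel)) X)"
      using Xm unfolding P_def by (rule finite_measure_distr)
  qed simp_all
  define S where "S = {x \<in> space P. rational_hit x b u}"
  have S: "S \<in> sets P"
    unfolding S_def by (rule rational_hit_measurable) (auto simp: P_def D_def)
  \<comment> \<open>The contact criterion reads only coordinates in \<open>D\<close>, so the
    undefined values of the restricted function do not matter.\<close>
  have restr: "rational_hit (\<lambda>q\<in>D. w q) b u \<longleftrightarrow> rational_hit w b u" for w
    unfolding rational_hit_def D_def[symmetric] by (intro ex_cong1 all_cong1 bex_cong) auto
  have XS: "X -` S \<inter> space M = {\<omega> \<in> space M. \<exists>s\<in>{0<..u}. bridge \<alpha> \<beta> \<gamma> s \<omega> \<le> b s}"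
  proof -
    have "rational_hit (\<lambda>s. bridge \<alpha> \<beta> \<gamma> s \<omega>) b u \<longleftrightarrow> (\<exists>s\<in>{0<..u}. bridge \<alpha> \<beta> \<gamma> s \<omega> \<le> b s)"
      if "\<omega> \<in> space M" for \<omega>
      by (rule rational_hit_iff[OF continuous_bridge[OF par u(2) that] bcont])
    moreover have "X \<omega> \<in> space P" if "\<omega> \<in> space M" for \<omega>
      using measurable_space[OF Xm that] .
    ultimately show ?thesis unfolding S_def by (auto simp: X_def restr)
  qed
  have YS: "Y -` S \<inter> space M = hits b u"
  proof -
    have "rational_hit (\<lambda>s. W s \<omega>) b u \<longleftrightarrow> (\<exists>s\<in>{0<..u}. W s \<omega> \<le> b s)"
      if "\<omega> \<in> space M" for \<omega>
      by (rule rational_hit_iff[OF continuous_on_subset[OF continuous_paths_pos[OF that]] bcont]) auto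
    moreover have "Y \<omega> \<in> space P" if "\<omega> \<in> space M" for \<omega>
      using measurable_space[OF Ym that] .
    ultimately show ?thesis unfolding S_def by (auto simp: Y_def restr)
  qed
  have "emeasure M {\<omega> \<in> space M. \<exists>s\<in>{0<..u}. bridge \<alpha> \<beta> \<gamma> s \<omega> \<le> b s} = emeasure (distr M P X) S"
    using XS by (simp add: emeasure_distr[OF Xm S])
  also have "\<dots> = emeasure (density M h) (hits b u)"
    unfolding eq using YS Ym S by (subst emeasure_distr) auto
  also have "\<dots> = (\<integral>\<^sup>+ \<omega>. h \<omega> * indicator (hits b u) \<omega> \<partial>M)"
    using hits_sets[OF b] by (simp add: emeasure_density)
  finally show ?thesis unfolding h_def .
qed

text \<open>Optional stopping evaluates the weight at (\<tau>, b \<tau>), which depends on \<tau>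
  alone; the expectation is then an integral against the law of \<tau>, that is, against
  \<open>f\<close>.\<close>

lemma emeasure_bridge_hits_density:
  fixes \<alpha> :: real
  assumes par: "0 \<le> \<beta>" "\<gamma> > 0" and u: "u > 0" "\<beta> * u < 1"
    and b: "continuous_on {0<..} b" "b \<in> borel_measurable borel"
    and f: "has_continuous_density M (first_passage_time W b) f"
  shows "emeasure M {\<omega> \<in> space M. \<exists>s\<in>{0<..u}. bridge \<alpha> \<beta> \<gamma> s \<omega> \<le> b s}
    = (\<integral>\<^sup>+ v \<in> {0<..u}. ennreal (bridge_weight \<beta> (\<alpha> / sqrt \<gamma>) v (b v) * f v) \<partial>lborel)"
proof -
  define \<eta> where "\<eta> = \<alpha> / sqrt \<gamma>"
  define F where "F = first_passage_time W b"
  define \<tau> where "\<tau> = (\<lambda>\<omega>. real_of_ereal (F \<omega>))"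
  note [measurable] = b(2)
  have Fm [measurable]: "F \<in> borel_measurable M" unfolding F_def by (rule first_passage_time_rv[OF b(1)])
  have F0: "0 \<le> F \<omega>" for \<omega> unfolding F_def by (rule first_passage_time_nonneg)
  have Hm [measurable]: "hits b u \<in> sets M" by (rule hits_sets[OF b(1)])
  have \<tau>m [measurable]: "\<tau> \<in> borel_measurable M" unfolding \<tau>_def by measurable
  have f0: "continuous_on {0<..} f" "\<And>t. t > 0 \<Longrightarrow> 0 \<le> f t"
    using f unfolding has_continuous_density_def by auto
  have law: "finite_law M F = density lborel (\<lambda>t. ennreal (f t) * indicator {0<..} t)"
    using f has_continuous_density_iff_finite_law[OF Fm F0 f0] unfolding F_def by blast
  note fm = measurable_density_on_pos[OF f0(1)]
  \<comment> \<open>The law has a Lebesgue density on the positive half-line and hence no atom at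
    0.\<close>
  have pos: "AE \<omega> in M. F \<omega> \<noteq> 0"
  proof (rule AE_I[where N = "{\<omega> \<in> space M. F \<omega> \<in> ereal ` {0}}"])
    have "emeasure M {\<omega> \<in> space M. F \<omega> \<in> ereal ` {0}} = emeasure (finite_law M F) {0}"
      by (subst emeasure_finite_law[OF Fm F0]) auto
    also have "\<dots> = 0"
      unfolding law using fm by (subst emeasure_density) (auto simp: nn_integral_0_iff_AE intro!: AE_I2 split: split_indicator)
    finally show "emeasure M {\<omega> \<in> space M. F \<omega> \<in> ereal ` {0}} = 0" .
    show "{\<omega> \<in> space M. F \<omega> \<in> ereal ` {0}} \<in> sets M"
    proof -
      have "{\<omega> \<in> space M. F \<omega> \<in> ereal ` {0}} = {\<omega> \<in> space M. F \<omega> = 0}" by (auto simp: zero_ereal_def)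
      then show ?thesis by simp
    qed
  qed (auto simp: zero_ereal_def)
  have c: "1 - \<beta> * v > 0" if "v \<le> u" for v by (rule scale_pos[OF par(1) that u(2)])
  have wm: "(\<lambda>v. bridge_weight \<beta> \<eta> v (b v)) \<in> borel_measurable borel"
    unfolding bridge_weight_def by measurable
  \<comment> \<open>Harmonicity of the weight: averaging it from time \<open>v\<close> to
    \<open>u\<close> returns its value at time \<open>v\<close>.\<close>
  have avg: "gauss_avg (sqrt (u - v)) (\<lambda>y. ennreal (bridge_weight \<beta> \<eta> u y)) x = ennreal (bridge_weight \<beta> \<eta> v x)"
    if "v \<le> u" for v x
    using gauss_avg_bridge_weight[OF c[OF that] c[OF order_refl] that, of "\<lambda>_. 1" \<eta> x] by simp
  \<comment> \<open>The condition \<open>F \<omega> \<noteq> \<infinity>\<close> is essential: on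
    paths without contact \<tau> takes the default value 0, which also lies below
    \<open>u\<close>.\<close>
  have hit: "\<omega> \<in> hits b u \<longleftrightarrow> F \<omega> \<noteq> \<infinity> \<and> \<tau> \<omega> \<le> u" if "\<omega> \<in> space M" for \<omega>
    unfolding in_hits_iff[OF b(1) that u(1)] F_def[symmetric] \<tau>_def
    using F0[of \<omega>] by (cases "F \<omega>") auto
  have "emeasure M {\<omega> \<in> space M. \<exists>s\<in>{0<..u}. bridge \<alpha> \<beta> \<gamma> s \<omega> \<le> b s}
     = (\<integral>\<^sup>+ \<omega>. ennreal (bridge_weight \<beta> \<eta> u (W u \<omega>)) * indicator (hits b u) \<omega> \<partial>M)"
    unfolding \<eta>_def by (rule emeasure_bridge_hits[OF par u b(1)])
  also have "\<dots> = (\<integral>\<^sup>+ \<omega>. gauss_avg (sqrt (u - \<tau> \<omega>)) (\<lambda>y. ennreal (bridge_weight \<beta> \<eta> u y)) (b (\<tau> \<omega>)) * indicator (hits b u) \<omega> \<partial>M)"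
    unfolding \<tau>_def F_def
    by (rule optional_stopping[OF b continuous_bridge_weight bridge_weight_nonneg u(1) pos[unfolded F_def]]) (rule u)
  also have "\<dots> = (\<integral>\<^sup>+ \<omega>. indicator {\<omega> \<in> space M. F \<omega> \<noteq> \<infinity>} \<omega> *
      (ennreal (bridge_weight \<beta> \<eta> (\<tau> \<omega>) (b (\<tau> \<omega>))) * indicator {..u} (\<tau> \<omega>)) \<partial>M)"
  proof (rule nn_integral_cong)
    fix \<omega> assume \<omega>: "\<omega> \<in> space M"
    show "gauss_avg (sqrt (u - \<tau> \<omega>)) (\<lambda>y. ennreal (bridge_weight \<beta> \<eta> u y)) (b (\<tau> \<omega>)) * indicator (hits b u) \<omega>
      = indicator {\<omega> \<in> space M. F \<omega> \<noteq> \<infinity>} \<omega> * (ennreal (bridge_weight \<beta> \<eta> (\<tau> \<omega>) (b (\<tau> \<omega>))) * indicator {..u} (\<tau> \<omega>))"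
    proof (cases "F \<omega> \<noteq> \<infinity> \<and> \<tau> \<omega> \<le> u")
      case True
      then have "\<omega> \<in> hits b u" using hit[OF \<omega>] by blast
      then show ?thesis using True \<omega> by (simp add: avg)
    next
      case False
      then have "\<omega> \<notin> hits b u" using hit[OF \<omega>] by blast
      then show ?thesis using False by (auto split: split_indicator)
    qed
  qed
  also have "\<dots> = (\<integral>\<^sup>+ v. ennreal (bridge_weight \<beta> \<eta> v (b v)) * indicator {..u} v \<partial>finite_law M F)"
    unfolding finite_law_def \<tau>_def[symmetric] using wm
    by (subst nn_integral_distr) (auto simp: nn_integral_density)
  also have "\<dots> = (\<integral>\<^sup>+ v. (ennreal (f v) * indicator {0<..} v) * (ennreal (bridge_weight \<beta> \<eta> v (b v)) * indicator {..u} v) \<partial>lborel)"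
    unfolding law using wm fm by (subst nn_integral_density) auto
  also have "\<dots> = (\<integral>\<^sup>+ v \<in> {0<..u}. ennreal (bridge_weight \<beta> \<eta> v (b v) * f v) \<partial>lborel)"
  proof (intro nn_integral_cong)
    fix v
    show "(ennreal (f v) * indicator {0<..} v) * (ennreal (bridge_weight \<beta> \<eta> v (b v)) * indicator {..u} v)
      = ennreal (bridge_weight \<beta> \<eta> v (b v) * f v) * indicator {0<..u} v"
    proof (cases "v \<in> {0<..u}")
      case True
      then have "0 \<le> f v" "0 \<le> bridge_weight \<beta> \<eta> v (b v)"
        using f0(2) c[of v] by (auto intro: bridge_weight_nonneg)
      then show ?thesis using True by (simp add: ennreal_mult mult.commute)
    qed (auto split: split_indicator)
  qed
  finally show ?thesis unfolding \<eta>_def .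
qed

end

section \<open>Densities\<close>

text \<open>The distribution function at positive times suffices: letting t decrease to 0 shows that
  there is no mass at or below 0, and the half-lines generate the Borel sets.\<close>

lemma has_continuous_densityI:
  assumes "finite_measure M" and \<tau> [measurable]: "\<tau> \<in> borel_measurable M" and nn: "\<And>\<omega>. 0 \<le> \<tau> \<omega>"
    and f: "continuous_on {0<..} f" "\<And>t. t > 0 \<Longrightarrow> 0 \<le> f t"
    and cdf: "\<And>t. t > 0 \<Longrightarrow> emeasure M {\<omega> \<in> space M. \<tau> \<omega> \<le> ereal t} = (\<integral>\<^sup>+ v \<in> {0<..t}. ennreal (f v) \<partial>lborel)"
  shows "has_continuous_density M \<tau> f"
proof -
  interpret finite_measure M by fact
  define \<mu> where "\<mu> = finite_law M \<tau>"
  define \<nu> where "\<nu> = density lborel (\<lambda>t. ennreal (f t) * indicator {0<..} t)"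
  have sets: "sets \<mu> = sets borel" "sets \<nu> = sets borel" by (simp_all add: \<mu>_def \<nu>_def)
  note fm = measurable_density_on_pos[OF f(1)]
  have \<mu>: "emeasure \<mu> {..t} = emeasure M {\<omega> \<in> space M. \<tau> \<omega> \<le> ereal t}" for t
  proof -
    have "emeasure \<mu> {..t} = emeasure M {\<omega> \<in> space M. \<tau> \<omega> \<in> ereal ` {..t}}"
      unfolding \<mu>_def by (rule emeasure_finite_law[OF \<tau> nn]) simp
    also have "{\<omega> \<in> space M. \<tau> \<omega> \<in> ereal ` {..t}} = {\<omega> \<in> space M. \<tau> \<omega> \<le> ereal t}"
    proof (rule Collect_cong, rule conj_cong[OF refl])
      fix \<omega>
      show "\<tau> \<omega> \<in> ereal ` {..t} \<longleftrightarrow> \<tau> \<omega> \<le> ereal t" using nn[of \<omega>] by (cases "\<tau> \<omega>") auto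
    qed
    finally show ?thesis .
  qed
  have \<nu>: "emeasure \<nu> {..t} = (\<integral>\<^sup>+ v \<in> {0<..t}. ennreal (f v) \<partial>lborel)" for t
    unfolding \<nu>_def using fm
    by (subst emeasure_density) (auto intro!: nn_integral_cong split: split_indicator)
  have pos: "emeasure \<mu> {..t} = emeasure \<nu> {..t}" if "t > 0" for t
    using \<mu> \<nu> cdf[OF that] by simp
  have fin: "emeasure \<mu> {..t} \<noteq> \<infinity>" for t unfolding \<mu> by simp
  \<comment> \<open>Continuity from above along 1/(n+1) needs finite mass on both sides; for \<nu>
    it is inherited from \<mu> through equality at positive times.\<close>
  have zero: "emeasure \<mu> {..0} = emeasure \<nu> {..0}"
  proof -
    have Int: "(\<Inter>n. {..1 / real (Suc n)}) = {..0::real}"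
    proof (intro set_eqI iffI)
      fix x :: real assume "x \<in> (\<Inter>n. {..1 / real (Suc n)})"
      then have "x \<le> 1 / real (Suc n)" for n by blast
      then have "\<not> x > 0" using reals_Archimedean[of x] by (metis inverse_eq_divide not_le)
      then show "x \<in> {..0}" by simp
    next
      fix x :: real assume "x \<in> {..0}"
      then have "x \<le> 1 / real (Suc n)" for n by (simp add: order_trans[of x 0])
      then show "x \<in> (\<Inter>n. {..1 / real (Suc n)})" by blast
    qed
    have dec: "decseq (\<lambda>n. {..1 / real (Suc n)})"
      by (rule decseq_SucI) (auto simp: field_simps elim: order_trans)
    have eq: "emeasure \<mu> {..1 / real (Suc n)} = emeasure \<nu> {..1 / real (Suc n)}" for n
      by (rule pos) simp
    have "(\<lambda>n. emeasure \<mu> {..1 / real (Suc n)}) \<longlonglongrightarrow> emeasure \<mu> (\<Inter>n. {..1 / real (Suc n)})"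
      by (rule Lim_emeasure_decseq[OF _ dec fin]) (auto simp: sets)
    moreover have "(\<lambda>n. emeasure \<nu> {..1 / real (Suc n)}) \<longlonglongrightarrow> emeasure \<nu> (\<Inter>n. {..1 / real (Suc n)})"
    proof (rule Lim_emeasure_decseq[OF _ dec])
      show "emeasure \<nu> {..1 / real (Suc n)} \<noteq> \<infinity>" for n unfolding eq[symmetric] by (rule fin)
    qed (auto simp: sets)
    ultimately show ?thesis unfolding Int eq by (rule LIMSEQ_unique)
  qed
  have all: "emeasure \<mu> {..t} = emeasure \<nu> {..t}" for t
  proof (cases "t > 0")
    case False
    then have sub: "{..t} \<subseteq> {..0}" by auto
    have "emeasure \<nu> {..0} = 0" unfolding \<nu> by simp
    then have "emeasure \<nu> {..t} = 0" "emeasure \<mu> {..t} = 0"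
      using emeasure_mono[OF sub, of \<nu>] emeasure_mono[OF sub, of \<mu>] zero sets by auto
    then show ?thesis by simp
  qed (rule pos)
  have "\<mu> = \<nu>"
  proof (rule measure_eqI_generator_eq[where E = "range (\<lambda>t::real. {..t})" and \<Omega> = UNIV and A = "\<lambda>n. {..real n}"])
    show "Int_stable (range (\<lambda>t::real. {..t}))" by (auto simp: Int_stable_def)
    show "sets \<mu> = sigma_sets UNIV (range (\<lambda>t::real. {..t}))"
      "sets \<nu> = sigma_sets UNIV (range (\<lambda>t::real. {..t}))"
      unfolding sets by (subst borel_eq_atMost, simp)+
    show "(\<Union>n. {..real n}) = UNIV" using real_arch_simple by auto
  qed (use all fin in auto)
  then show ?thesis
    using has_continuous_density_iff_finite_law[OF \<tau> nn f] unfolding \<mu>_def \<nu>_def by blast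
qed

text \<open>At time \<gamma> r / q one has 1 - \<beta> (\<gamma> r / q) = 1 / q. Hence the weight
  contributes \<open>sqrt q\<close>, which together with the Jacobian \<gamma> / q^2 leaves the
  power 3/2 of \<open>q\<close> in the denominator.\<close>

lemma bridge_weight_time_change:
  fixes \<alpha> \<beta> \<gamma> r x y :: real
  assumes "\<gamma> > 0" and q: "1 + \<beta> * \<gamma> * r > 0"
  defines "q \<equiv> 1 + \<beta> * \<gamma> * r"
  shows "bridge_weight \<beta> (\<alpha> / sqrt \<gamma>) (\<gamma> * r / q) x * y * (\<gamma> / q\<^sup>2)
    = \<gamma> * y / q powr (3/2) * exp (- q * x * (\<beta> / 2 * x + \<alpha> / sqrt \<gamma>) - \<alpha>\<^sup>2 * r / 2)"
proof -
  have q0: "q > 0" using q by (simp add: q_def)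
  have c: "1 - \<beta> * (\<gamma> * r / q) = 1 / q"
    using q0 by (simp add: field_simps) (simp add: q_def)
  define \<eta> where "\<eta> = \<alpha> / sqrt \<gamma>"
  have \<eta>: "\<eta>\<^sup>2 * \<gamma> = \<alpha>\<^sup>2" using assms(1) by (simp add: \<eta>_def power_divide)
  have e: "- (\<beta> * x\<^sup>2 / 2 + \<eta> * x + \<eta>\<^sup>2 * (\<gamma> * r / q) / 2) / (1 / q) = - q * x * (\<beta> / 2 * x + \<eta>) - \<alpha>\<^sup>2 * r / 2"
  proof -
    have "- (\<beta> * x\<^sup>2 / 2 + \<eta> * x + \<eta>\<^sup>2 * (\<gamma> * r / q) / 2) / (1 / q)
      = - (q * (\<beta> * x\<^sup>2 / 2 + \<eta> * x)) - (\<eta>\<^sup>2 * \<gamma>) * r / 2"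
      using q0 by (simp add: field_simps)
    then show ?thesis unfolding \<eta> by (simp add: power2_eq_square algebra_simps)
  qed
  have s: "sqrt q * sqrt q = q" using q0 by simp
  have "q powr (3/2) = q powr (1 + 1/2)" by simp
  also have "\<dots> = q * sqrt q" using q0 by (simp only: powr_add powr_half_sqrt powr_one less_imp_le)
  finally have p: "q powr (3/2) = q * sqrt q" .
  define E where "E = exp (- q * x * (\<beta> / 2 * x + \<eta>) - \<alpha>\<^sup>2 * r / 2)"
  have w: "bridge_weight \<beta> \<eta> (\<gamma> * r / q) x = E * sqrt q"
    unfolding bridge_weight_def c e E_def by (simp add: real_sqrt_divide)
  have k: "sqrt q * (\<gamma> / q\<^sup>2) = \<gamma> / (q * sqrt q)"
  proof -
    have "\<gamma> / (q * sqrt q) = (\<gamma> * sqrt q) / (q * sqrt q * sqrt q)"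
      using q0 by (intro mult_divide_mult_cancel_right[symmetric]) simp
    also have "\<dots> = sqrt q * (\<gamma> / q\<^sup>2)"
      unfolding mult.assoc s power2_eq_square by simp
    finally show ?thesis ..
  qed
  have "bridge_weight \<beta> \<eta> (\<gamma> * r / q) x * y * (\<gamma> / q\<^sup>2) = sqrt q * (\<gamma> / q\<^sup>2) * y * E"
    unfolding w by (simp only: ac_simps)
  also have "\<dots> = \<gamma> * y / q powr (3/2) * E"
    unfolding k p by simp
  finally show ?thesis unfolding E_def \<eta>_def .
qed

theorem theorem4:
  fixes M :: "'a measure" and W :: "real \<Rightarrow> 'a \<Rightarrow> real"
    and b bt f :: "real \<Rightarrow> real" and \<epsilon> \<alpha> \<beta> \<gamma> :: real
  assumes "standard_brownian_motion M W"
    and "regular_boundary M W b"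
    and "\<And>T. T > 0 \<Longrightarrow> b C1_differentiable_on {0<..T}"
    and "0 < \<epsilon>" and "\<epsilon> < 1/2"
    and "(\<lambda>t. \<bar>deriv b t\<bar>) \<in> O[at_right 0](\<lambda>t. t powr (-\<epsilon>))"
    and "has_continuous_density M (first_passage_time W b) f"
    and "\<beta> \<ge> 0" and "\<gamma> > 0"
    and "\<And>t. t > 0 \<Longrightarrow>
      bt t = (1 + \<beta> * \<gamma> * t) / sqrt \<gamma> * b (\<gamma> * t / (1 + \<beta> * \<gamma> * t)) + \<alpha> * t"
  shows "has_continuous_density M (first_passage_time W bt)
    (\<lambda>t. \<gamma> * f (\<gamma> * t / (1 + \<beta> * \<gamma> * t)) / (1 + \<beta> * \<gamma> * t) powr (3/2) *
      exp (- (1 + \<beta> * \<gamma> * t) * b (\<gamma> * t / (1 + \<beta> * \<gamma> * t)) *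
             (\<beta> / 2 * b (\<gamma> * t / (1 + \<beta> * \<gamma> * t)) + \<alpha> / sqrt \<gamma>)
           - \<alpha>\<^sup>2 * t / 2))"
proof -
  interpret standard_brownian_motion M W by fact
  note \<beta> = \<open>\<beta> \<ge> 0\<close> and \<gamma> = \<open>\<gamma> > 0\<close> and bt = assms(10)
  have b: "continuous_on {0<..} b" using assms(2) by (simp add: regular_boundary_def boundary_def)
  have f: "continuous_on {0<..} f" "\<And>t. t > 0 \<Longrightarrow> 0 \<le> f t"
    using assms(7) unfolding has_continuous_density_def by auto
  define q where "q t = 1 + \<beta> * \<gamma> * t" for t
  define g where "g t = \<gamma> * t / q t" for t
  define F where "F t = \<gamma> * f (g t) / q t powr (3/2) *
    exp (- q t * b (g t) * (\<beta> / 2 * b (g t) + \<alpha> / sqrt \<gamma>) - \<alpha>\<^sup>2 * t / 2)" for t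
  have q: "q t > 0" if "t \<ge> 0" for t using \<beta> \<gamma> that unfolding q_def by (simp add: add_pos_nonneg)
  have g: "g t > 0" if "t > 0" for t using q[of t] \<gamma> that by (simp add: g_def)
  have q_cont: "continuous_on S q" for S unfolding q_def by (intro continuous_intros)
  have g_cont: "continuous_on {0<..} g"
    unfolding g_def using q by (intro continuous_intros q_cont) (auto simp: less_imp_neq[symmetric])
  have bg: "continuous_on {0<..} (\<lambda>t. b (g t))"
    by (rule continuous_on_compose2[OF b g_cont]) (use g in auto)
  have fg: "continuous_on {0<..} (\<lambda>t. f (g t))"
    by (rule continuous_on_compose2[OF f(1) g_cont]) (use g in auto)
  have bt_cont: "continuous_on {0<..} bt"
  proof -
    have "continuous_on {0<..} (\<lambda>t. q t / sqrt \<gamma> * b (g t) + \<alpha> * t)"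
      using \<gamma> by (intro continuous_intros q_cont bg) auto
    then show ?thesis
      by (rule continuous_on_eq) (use bt in \<open>auto simp: q_def g_def\<close>)
  qed
  have F_cont: "continuous_on {0<..} F"
    unfolding F_def using q by (intro continuous_intros q_cont bg fg) (auto simp: less_imp_neq[symmetric])
  have F_nonneg: "0 \<le> F t" if "t > 0" for t
    using f(2)[OF g[OF that]] \<gamma> by (simp add: F_def)
  have cg: "1 - \<beta> * g t = 1 / q t" if "t > 0" for t
    using q[of t] that by (simp add: g_def field_simps) (simp add: q_def)
  have \<beta>g: "\<beta> * g t < 1" if "t > 0" for t
  proof -
    have "0 < 1 / q t" using q[of t] that by simp
    then show ?thesis using cg[OF that] by linarith
  qed
  have clock_g: "clock \<beta> \<gamma> (g t) = t" if "t > 0" for t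
    unfolding clock_def cg[OF that] using q[of t] \<gamma> that by (simp add: g_def)
  have bridge_g: "W t \<omega> \<le> bt t \<longleftrightarrow> bridge \<alpha> \<beta> \<gamma> (g t) \<omega> \<le> b (g t)" if "t > 0" for t \<omega>
  proof -
    have pos: "sqrt \<gamma> > 0" "q t > 0" using \<gamma> q that by auto
    have "bridge \<alpha> \<beta> \<gamma> (g t) \<omega> = sqrt \<gamma> / q t * (W t \<omega> - \<alpha> * t)"
      unfolding bridge_def clock_g[OF that] cg[OF that] by simp
    then have "q t * bridge \<alpha> \<beta> \<gamma> (g t) \<omega> = sqrt \<gamma> * (W t \<omega> - \<alpha> * t)" using pos by simp
    moreover have "bt t = q t / sqrt \<gamma> * b (g t) + \<alpha> * t" using bt[OF that] by (simp add: q_def g_def)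
    then have "sqrt \<gamma> * (bt t - \<alpha> * t) = q t * b (g t)" using pos by simp
    ultimately have e: "sqrt \<gamma> * (bt t - W t \<omega>) = q t * (b (g t) - bridge \<alpha> \<beta> \<gamma> (g t) \<omega>)"
      unfolding right_diff_distrib by linarith
    have z: "0 \<le> k * z \<longleftrightarrow> 0 \<le> z" if "k > 0" for k z :: real
      using that by (simp add: zero_le_mult_iff)
    have "0 \<le> bt t - W t \<omega> \<longleftrightarrow> 0 \<le> b (g t) - bridge \<alpha> \<beta> \<gamma> (g t) \<omega>"
      using z[OF pos(1), of "bt t - W t \<omega>"] z[OF pos(2), of "b (g t) - bridge \<alpha> \<beta> \<gamma> (g t) \<omega>"]
      unfolding e by blast
    then show ?thesis by simp
  qed
  have g_clock: "g (clock \<beta> \<gamma> s) = s \<and> clock \<beta> \<gamma> s > 0" if "s > 0" "\<beta> * s < 1" for s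
  proof -
    have c: "1 - \<beta> * s > 0" using that by simp
    have "q (clock \<beta> \<gamma> s) = 1 / (1 - \<beta> * s)"
      using c \<gamma> by (simp add: q_def clock_def field_simps)
    then have "g (clock \<beta> \<gamma> s) = s" unfolding g_def clock_def using c \<gamma> by simp
    moreover have "clock \<beta> \<gamma> s > 0" unfolding clock_def using c \<gamma> that by simp
    ultimately show ?thesis ..
  qed
  have g_mono: "g s \<le> g t" if "0 < s" "s \<le> t" for s t
  proof -
    have "\<gamma> * s * q t \<le> \<gamma> * t * q s" using that \<gamma> by (simp add: q_def algebra_simps)
    then show ?thesis using q[of s] q[of t] that by (simp add: g_def divide_le_eq pos_le_divide_eq field_simps)
  qed
  \<comment> \<open>\<open>g\<close> and \<open>clock\<close> are mutually inverse increasing maps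
    between (0,t] and (0,g t], and \<open>bridge_g\<close> matches contacts at corresponding
    times.\<close>
  have hit_eq: "{\<omega> \<in> space M. \<exists>r\<in>{0<..t}. W r \<omega> \<le> bt r}
      = {\<omega> \<in> space M. \<exists>s\<in>{0<..g t}. bridge \<alpha> \<beta> \<gamma> s \<omega> \<le> b s}" if t: "t > 0" for t
  proof (rule Collect_cong, rule conj_cong[OF refl])
    fix \<omega>
    show "(\<exists>r\<in>{0<..t}. W r \<omega> \<le> bt r) \<longleftrightarrow> (\<exists>s\<in>{0<..g t}. bridge \<alpha> \<beta> \<gamma> s \<omega> \<le> b s)"
    proof
      assume "\<exists>r\<in>{0<..t}. W r \<omega> \<le> bt r"
      then obtain r where "0 < r" "r \<le> t" "W r \<omega> \<le> bt r" by auto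
      then show "\<exists>s\<in>{0<..g t}. bridge \<alpha> \<beta> \<gamma> s \<omega> \<le> b s"
        using bridge_g[of r] g[of r] g_mono[of r t] by (intro bexI[of _ "g r"]) auto
    next
      assume "\<exists>s\<in>{0<..g t}. bridge \<alpha> \<beta> \<gamma> s \<omega> \<le> b s"
      then obtain s where s: "0 < s" "s \<le> g t" "bridge \<alpha> \<beta> \<gamma> s \<omega> \<le> b s" by auto
      have "1 - \<beta> * s > 0" by (rule scale_pos[OF \<beta> s(2) \<beta>g[OF t]])
      then have gc: "g (clock \<beta> \<gamma> s) = s" "clock \<beta> \<gamma> s > 0" using g_clock[OF s(1)] by auto
      have "clock \<beta> \<gamma> s \<le> t" using clock_mono[OF \<beta> \<gamma> s(2) \<beta>g[OF t]] clock_g[OF t] by simp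
      then show "\<exists>r\<in>{0<..t}. W r \<omega> \<le> bt r"
        using bridge_g[OF gc(2), of \<omega>] gc s by (intro bexI[of _ "clock \<beta> \<gamma> s"]) auto
    qed
  qed
  \<comment> \<open>\<open>b\<close> may fail to be measurable because of its arbitrary values at
    nonpositive times. Setting these to 0 changes neither contacts nor passage times.\<close>
  define b0 where "b0 t = indicator {0<..} t *\<^sub>R b t" for t
  have b0: "b0 t = b t" if "t > 0" for t using that by (simp add: b0_def)
  have b0_cont: "continuous_on {0<..} b0" by (rule continuous_on_eq[OF b]) (simp add: b0)
  have b0_meas: "b0 \<in> borel_measurable borel"
    unfolding b0_def by (rule borel_measurable_continuous_on_indicator[OF _ b]) simp
  have "first_passage_time W b0 = first_passage_time W b"
    unfolding first_passage_time_def by (intro ext arg_cong[where f = Inf] arg_cong[where f = "image ereal"] Collect_cong) (auto simp: b0)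
  then have b0_dens: "has_continuous_density M (first_passage_time W b0) f" using assms(7) by simp
  define \<phi> where "\<phi> v = indicator {0<..} v *\<^sub>R (bridge_weight \<beta> (\<alpha> / sqrt \<gamma>) v (b0 v) * f v)" for v
  have \<phi>_meas: "\<phi> \<in> borel_measurable borel"
  proof -
    have [measurable]: "(\<lambda>v. indicator {0<..} v *\<^sub>R f v) \<in> borel_measurable borel" "b0 \<in> borel_measurable borel"
      by (rule borel_measurable_continuous_on_indicator[OF _ f(1)], simp, rule b0_meas)
    have "(\<lambda>v. bridge_weight \<beta> (\<alpha> / sqrt \<gamma>) v (b0 v) * (indicator {0<..} v *\<^sub>R f v)) \<in> borel_measurable borel"
      unfolding bridge_weight_def by measurable
    also have "(\<lambda>v. bridge_weight \<beta> (\<alpha> / sqrt \<gamma>) v (b0 v) * (indicator {0<..} v *\<^sub>R f v)) = \<phi>"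
      unfolding \<phi>_def by (auto split: split_indicator)
    finally show ?thesis .
  qed
  have cdf: "emeasure M {\<omega> \<in> space M. first_passage_time W bt \<omega> \<le> ereal t} = (\<integral>\<^sup>+ v \<in> {0<..t}. ennreal (F v) \<partial>lborel)"
    if t: "t > 0" for t
  proof -
    have "{\<omega> \<in> space M. first_passage_time W bt \<omega> \<le> ereal t} = hits bt t"
      using in_hits_iff[OF bt_cont _ t] by blast
    also have "\<dots> = {\<omega> \<in> space M. \<exists>s\<in>{0<..g t}. bridge \<alpha> \<beta> \<gamma> s \<omega> \<le> b0 s}"
      unfolding hit_eq[OF t] by (auto simp: b0)
    also have "emeasure M \<dots> = (\<integral>\<^sup>+ v \<in> {0<..g t}. ennreal (bridge_weight \<beta> (\<alpha> / sqrt \<gamma>) v (b0 v) * f v) \<partial>lborel)"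
      by (rule emeasure_bridge_hits_density[OF \<beta> \<gamma> g[OF t] \<beta>g[OF t] b0_cont b0_meas b0_dens])
    \<comment> \<open>The substitution rule works with closed intervals; the added end point
      \<open>g 0 = 0\<close> is harmless because \<phi> vanishes there.\<close>
    also have "\<dots> = (\<integral>\<^sup>+ v. ennreal (\<phi> v * indicator {g 0..g t} v) \<partial>lborel)"
      by (intro nn_integral_cong) (auto simp: \<phi>_def g_def split: split_indicator)
    also have "\<dots> = (\<integral>\<^sup>+ r. ennreal (\<phi> (g r) * (\<gamma> / (q r)\<^sup>2) * indicator {0..t} r) \<partial>lborel)"
    proof (rule nn_integral_substitution)
      show "set_borel_measurable borel {g 0..g t} \<phi>"
        using \<phi>_meas unfolding set_borel_measurable_def by measurable
      show "(g has_real_derivative \<gamma> / (q x)\<^sup>2) (at x)" if "x \<in> {0..t}" for x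
      proof -
        have "q x \<noteq> 0" using q[of x] that by simp
        then show ?thesis unfolding g_def q_def
          by (auto intro!: derivative_eq_intros simp: field_simps power2_eq_square)
      qed
      show "continuous_on {0..t} (\<lambda>x. \<gamma> / (q x)\<^sup>2)"
        using q by (intro continuous_intros q_cont) (auto simp: less_imp_neq[symmetric])
    qed (use \<gamma> t in auto)
    also have "\<dots> = (\<integral>\<^sup>+ v \<in> {0<..t}. ennreal (F v) \<partial>lborel)"
    proof (rule nn_integral_cong)
      fix r :: real
      show "ennreal (\<phi> (g r) * (\<gamma> / (q r)\<^sup>2) * indicator {0..t} r) = ennreal (F r) * indicator {0<..t} r"
      proof (cases "r \<in> {0<..t}")
        case True
        then have r: "r > 0" by simp
        have "\<phi> (g r) * (\<gamma> / (q r)\<^sup>2) = bridge_weight \<beta> (\<alpha> / sqrt \<gamma>) (g r) (b (g r)) * f (g r) * (\<gamma> / (q r)\<^sup>2)"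
          using g[OF r] by (simp add: \<phi>_def b0)
        also have "\<dots> = F r"
          using bridge_weight_time_change[OF \<gamma>, of \<beta> r \<alpha> "b (g r)" "f (g r)"] q[of r] r
          unfolding F_def g_def q_def by simp
        finally show ?thesis using True by simp
      next
        case False
        then show ?thesis by (auto simp: \<phi>_def g_def split: split_indicator)
      qed
    qed
    finally show ?thesis .
  qed
  have "has_continuous_density M (first_passage_time W bt) F"
    by (rule has_continuous_densityI[OF finite_measure_axioms first_passage_time_rv[OF bt_cont]
          first_passage_time_nonneg F_cont F_nonneg cdf])
  then show ?thesis unfolding F_def g_def q_def .
qed

end
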